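(* For every integer $n\ge2$ and every real $0<q<3$, $$\mathbb{E}\lVert C_n\rVert^{-2q}\le\prod_{j=2}^n\frac{\Gamma(2j-1-q)}{\Gamma(2j-1)} .$$ For every integer $n\ge1$ and every real $0<q<1$, $$\mathbb{E}|H_n|^{-2q}\le\prod_{j=1}^n\frac{\Gamma(2j-1-q)}{\Gamma(2j-1)} .$$
   Context: For a symmetric $2k\times 2k$ complex matrix $A=(a_{ij})$, $\operatorname{haf}(A)=\sum_{M}\prod_{\{i,j\}\in M}a_{ij}$, summed over all perfect matchings $M$ of the index set; the hafnian of the empty matrix is $1$; the diagonal is irrelevant. $\mathcal{CN}(0,1)$ is the standard circular complex Gaussian law (independent centered real Gaussian real and imaginary parts of variance $1/2$). $G_{2n}$ is a $2n\times2n$ complex symmetric random matrix with independent $\mathcal{CN}(0,1)$ entries above the diagonal, and $H_n=\operatorname{haf}(G_{2n})$. $B_{2n-1}$ is a $(2n-1)\times(2n-1)$ complex symmetric random matrix with independent $\mathcal{CN}(0,1)$ entries above the diagonal, and $C_n\in\mathbb{C}^{2n-1}$ is its hafnian cofactor vector, $(C_n)_j=\operatorname{haf}((B_{2n-1})_{-j})$, $1\le j\le 2n-1$, where $(\cdot)_{-j}$ means deleting row and column $j$ (so $C_1=(1)$). $\lVert\cdot\rVert$ is the Euclidean norm and $\Gamma$ is the Gamma function. *)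

theory Defs
  imports "HOL-Probability.Probability"
begin

text \<open>Matrices of varying size are functions on pairs of indices together with a finite index
  set of natural numbers; deleting row and column \<open>j\<close> is removing \<open>j\<close> from the index set.\<close>

definition perfect_matchings :: "nat set \<Rightarrow> nat set set set" where
  "perfect_matchings I = {M. partition_on I M \<and> (\<forall>e\<in>M. card e = 2)}"

text \<open>For an edge \<open>e = {i, j}\<close> with \<open>i < j\<close> the factor is the entry \<open>(i, j)\<close> above the diagonal;
  for a symmetric matrix the choice of orientation does not matter.\<close>

definition haf :: "nat set \<Rightarrow> (nat \<Rightarrow> nat \<Rightarrow> complex) \<Rightarrow> complex" where
  "haf I A = (\<Sum>M\<in>perfect_matchings I. \<Prod>e\<in>M. A (Min e) (Max e))"

definition haf_cofactor :: "nat set \<Rightarrow> (nat \<Rightarrow> nat \<Rightarrow> complex) \<Rightarrow> nat \<Rightarrow> complex" where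
  "haf_cofactor I A j = haf (I - {j}) A"

lemma perfect_matchings_empty: "perfect_matchings {} = {{}}"
  by (auto simp: perfect_matchings_def partition_on_def)

lemma haf_empty: "haf {} A = 1"
  by (simp add: haf_def perfect_matchings_empty)

definition std_complex_gaussian :: "'w measure \<Rightarrow> ('w \<Rightarrow> complex) \<Rightarrow> bool" where
  "std_complex_gaussian P X \<longleftrightarrow>
     prob_space.indep_var P borel (\<lambda>w. Re (X w)) borel (\<lambda>w. Im (X w)) \<and>
     distributed P lborel (\<lambda>w. Re (X w)) (normal_density 0 (sqrt (1/2))) \<and>
     distributed P lborel (\<lambda>w. Im (X w)) (normal_density 0 (sqrt (1/2)))"

text \<open>Nothing is assumed about the diagonal entries except that they are random variables.\<close>

definition gaussian_symmetric_matrix ::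
    "'w measure \<Rightarrow> nat \<Rightarrow> ('w \<Rightarrow> nat \<Rightarrow> nat \<Rightarrow> complex) \<Rightarrow> bool" where
  "gaussian_symmetric_matrix P m A \<longleftrightarrow>
     prob_space P \<and>
     (\<forall>i\<in>{1..m}. \<forall>j\<in>{1..m}. (\<lambda>w. A w i j) \<in> borel_measurable P) \<and>
     (\<forall>w\<in>space P. \<forall>i\<in>{1..m}. \<forall>j\<in>{1..m}. A w i j = A w j i) \<and>
     prob_space.indep_vars P (\<lambda>_. borel) (\<lambda>(i, j) w. A w i j) {(i, j). 1 \<le> i \<and> i < j \<and> j \<le> m} \<and>
     (\<forall>i j. 1 \<le> i \<and> i < j \<and> j \<le> m \<longrightarrow> std_complex_gaussian P (\<lambda>w. A w i j))"

text \<open>The expectation of \<open>X\<close> to the power \<open>-p\<close> for nonnegative \<open>X\<close> and \<open>p > 0\<close>, as an element of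
  \<open>[0, \<infinity>]\<close>. The inverse is taken in \<^typ>\<open>ennreal\<close>, so the integrand is \<open>\<infinity>\<close> where \<open>X\<close> vanishes
  (whereas \<open>0 powr (-p) = 0\<close> over the reals).\<close>

definition inverse_moment :: "'w measure \<Rightarrow> real \<Rightarrow> ('w \<Rightarrow> real) \<Rightarrow> ennreal" where
  "inverse_moment P p X = (\<integral>\<^sup>+ w. inverse (ennreal (X w powr p)) \<partial>P)"

end

theory Submission
  imports Defs
begin

text \<open>Fix \<open>V\<close> of odd size and write \<open>C\<close> for the hafnian cofactor vector of the random edge weights
  \<open>b\<close> on \<open>V\<close>. The core is a rotation inequality: for a deterministic vector \<open>g\<close>,
  \<open>\<bar>E exp (i Re \<langle>g, C\<rangle>)\<bar>\<close> does not decrease when two coordinates \<open>g\<^sub>u\<close>, \<open>g\<^sub>v\<close> are replaced by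
  \<open>0\<close> and a number of modulus \<open>\<surd>(\<bar>g\<^sub>u\<bar>\<^sup>2 + \<bar>g\<^sub>v\<bar>\<^sup>2)\<close>. Conditionally on the weights avoiding \<open>u\<close> and
  \<open>v\<close>, the exponent is \<open>x\<^sup>T S y + g\<^sub>u t \<cdot> y + g\<^sub>v t \<cdot> x\<close> with Gaussian rows \<open>x\<close>, \<open>y\<close> and a symmetric
  matrix \<open>S\<close> (up to an independent Gaussian factor), and the modulus of this conditional expectation
  only depends on \<open>\<bar>g\<^sub>u\<bar>\<^sup>2 + \<bar>g\<^sub>v\<bar>\<^sup>2\<close>, while for \<open>g\<^sub>u = 0\<close> the expectation is a nonnegative real.

  After all coordinates have been merged into \<open>v\<close>, only the hafnian of \<open>V - {v}\<close> is left, and expanding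
  it along a row bounds the characteristic function by \<open>E exp (- \<bar>g\<bar>\<^sup>2 \<bar>C'\<bar>\<^sup>2 / 4)\<close>, where \<open>C'\<close> is the
  cofactor vector on two vertices fewer. Taking \<open>g\<close> Gaussian, the Laplace transform of \<open>\<bar>C\<bar>\<^sup>2\<close> is
  bounded by that of \<open>\<bar>g\<bar>\<^sup>2 \<bar>C'\<bar>\<^sup>2\<close> with independent factors, and \<open>E \<bar>g\<bar>\<^sup>-\<^sup>2\<^sup>q = \<Gamma>(d - q) / \<Gamma>(d)\<close>
  for \<open>g\<close> of dimension \<open>d\<close>.\<close>

section \<open>The standard complex Gaussian measure\<close>

definition cgauss :: "complex measure" where
  "cgauss = density lborel (\<lambda>z. ennreal (exp (- (cmod z)\<^sup>2) / pi))"

lemma sets_cgauss [measurable_cong, simp]: "sets cgauss = sets borel"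
  by (simp add: cgauss_def)

lemma space_cgauss [simp]: "space cgauss = UNIV"
  by (simp add: cgauss_def)

lemma lborel_complex: "distr (lborel \<Otimes>\<^sub>M lborel) borel (\<lambda>(x, y). Complex x y) = lborel"
proof -
  have [measurable]: "(\<lambda>(x, y). Complex x y) \<in> borel \<Otimes>\<^sub>M borel \<rightarrow>\<^sub>M borel"
    unfolding Complex_eq by measurable
  show ?thesis
  proof (rule lborel_eqI[symmetric])
    fix l u :: complex
    assume "\<And>b. b \<in> Basis \<Longrightarrow> l \<bullet> b \<le> u \<bullet> b"
    from this[of 1] this[of \<i>] have le: "Re l \<le> Re u" "Im l \<le> Im u"
      by (auto simp: Basis_complex_def inner_complex_def)
    have *: "(\<lambda>(x, y). Complex x y) -` box l u \<inter> space (lborel \<Otimes>\<^sub>M lborel)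
        = {Re l<..<Re u} \<times> {Im l<..<Im u}"
      by (auto simp: box_def Basis_complex_def inner_complex_def space_pair_measure)
    show "emeasure (distr (lborel \<Otimes>\<^sub>M lborel) borel (\<lambda>(x, y). Complex x y)) (box l u)
        = ennreal (\<Prod>b\<in>Basis. (u - l) \<bullet> b)"
      using le by (subst emeasure_distr)
        (auto simp: * lborel.emeasure_pair_measure_Times Basis_complex_def inner_complex_def
          ennreal_mult)
  qed simp
qed

lemma distr_normal_cgauss:
  defines "N \<equiv> density lborel (normal_density 0 (sqrt (1/2)))"
  shows "distr (N \<Otimes>\<^sub>M N) borel (\<lambda>(x, y). Complex x y) = cgauss"
proof -
  have [measurable]: "(\<lambda>(x, y). Complex x y) \<in> borel \<Otimes>\<^sub>M borel \<rightarrow>\<^sub>M borel"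
    unfolding Complex_eq by measurable
  interpret N: prob_space N
    unfolding N_def by (rule prob_space_normal_density) simp
  have NN: "N \<Otimes>\<^sub>M N = density (lborel \<Otimes>\<^sub>M lborel)
      (\<lambda>(x, y). ennreal (normal_density 0 (sqrt (1/2)) x) * ennreal (normal_density 0 (sqrt (1/2)) y))"
    unfolding N_def
    by (rule pair_measure_density)
       (auto intro: sigma_finite_lborel N.sigma_finite_measure_axioms[unfolded N_def])
  have dens: "ennreal (normal_density 0 (sqrt (1/2)) x) * ennreal (normal_density 0 (sqrt (1/2)) y)
      = ennreal (exp (- (cmod (Complex x y))\<^sup>2) / pi)" for x y
    by (simp add: ennreal_mult[symmetric] normal_density_def cmod_power2 exp_add[symmetric]
        real_sqrt_mult[symmetric] field_simps)
  have "cgauss = density (distr (lborel \<Otimes>\<^sub>M lborel) borel (\<lambda>(x, y). Complex x y))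
      (\<lambda>z. ennreal (exp (- (cmod z)\<^sup>2) / pi))"
    unfolding lborel_complex cgauss_def ..
  also have "\<dots> = distr (density (lborel \<Otimes>\<^sub>M lborel)
      (\<lambda>p. ennreal (exp (- (cmod (case p of (x, y) \<Rightarrow> Complex x y))\<^sup>2) / pi))) borel
      (\<lambda>(x, y). Complex x y)"
    by (rule density_distr) auto
  also have "\<dots> = distr (N \<Otimes>\<^sub>M N) borel (\<lambda>(x, y). Complex x y)"
    unfolding NN by (simp add: dens split_beta')
  finally show ?thesis ..
qed

interpretation cgauss: prob_space cgauss
proof -
  define N where "N = density lborel (normal_density 0 (sqrt (1/2)))"
  interpret N: prob_space N
    unfolding N_def by (rule prob_space_normal_density) simp
  interpret NN: pair_prob_space N N ..
  have [measurable]: "(\<lambda>(x, y). Complex x y) \<in> N \<Otimes>\<^sub>M N \<rightarrow>\<^sub>M borel"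
    unfolding Complex_eq N_def by measurable
  show "prob_space cgauss"
    unfolding distr_normal_cgauss[folded N_def, symmetric]
    by (rule NN.prob_space_distr) simp
qed

lemma std_complex_gaussian_distr:
  assumes "prob_space P" and "std_complex_gaussian P X"
  shows "distr P borel X = cgauss"
proof -
  interpret prob_space P by fact
  note X = assms(2)[unfolded std_complex_gaussian_def]
  define N where "N = density lborel (normal_density 0 (sqrt (1/2)))"
  have [measurable]: "(\<lambda>(x, y). Complex x y) \<in> borel \<Otimes>\<^sub>M borel \<rightarrow>\<^sub>M borel"
    unfolding Complex_eq by measurable
  note ind = conjunct1[OF X, unfolded indep_var_distribution_eq]
  have [measurable]: "(\<lambda>w. Re (X w)) \<in> borel_measurable P" "(\<lambda>w. Im (X w)) \<in> borel_measurable P"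
    using ind by auto
  have "distr P borel (\<lambda>w. Re (X w)) = N" "distr P borel (\<lambda>w. Im (X w)) = N"
    using X[THEN conjunct2, THEN conjunct1, THEN distributed_distr_eq_density]
      X[THEN conjunct2, THEN conjunct2, THEN distributed_distr_eq_density] unfolding N_def
    by (metis distr_cong sets_lborel)+
  then have "N \<Otimes>\<^sub>M N = distr P (borel \<Otimes>\<^sub>M borel) (\<lambda>w. (Re (X w), Im (X w)))"
    using ind by simp
  then have "cgauss = distr (distr P (borel \<Otimes>\<^sub>M borel) (\<lambda>w. (Re (X w), Im (X w)))) borel
      (\<lambda>(x, y). Complex x y)"
    using distr_normal_cgauss[folded N_def] by simp
  also have "\<dots> = distr P borel X"
    by (subst distr_distr) (auto simp: o_def)
  finally show ?thesis ..
qed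

lemma normal_half_char:
  "(\<integral>x. cis (t * x) \<partial>density lborel (normal_density 0 (sqrt (1/2)))) = exp (- t\<^sup>2 / 4)"
proof -
  define N where "N = density lborel (normal_density 0 (sqrt (1/2)))"
  interpret N: prob_space N
    unfolding N_def by (rule prob_space_normal_density) simp
  have d: "distributed N lborel (\<lambda>x. x) (normal_density 0 (sqrt (1/2)))"
    unfolding distributed_def by (auto simp: N_def intro!: distr_id2)
  have "distributed N lborel (\<lambda>x. (x - 0) / sqrt (1/2)) std_normal_density"
    using d by (rule N.normal_standard_normal_convert[THEN iffD1, rotated]) simp
  then have "distr N lborel (\<lambda>x. x / sqrt (1/2)) = std_normal_distribution"
    by (simp add: distributed_def)
  then have "char std_normal_distribution (t * sqrt (1/2))
      = (\<integral>x. cis (t * sqrt (1/2) * (x / sqrt (1/2))) \<partial>N)"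
    unfolding char_def by (subst (asm) eq_commute) (simp only:,
      subst integral_distr, auto simp: N_def cis_conv_exp)
  then show ?thesis
    unfolding char_std_normal_distribution N_def
    by (simp add: power_mult_distrib real_sqrt_divide power_divide)
qed

lemma cgauss_char: "(\<integral>z. cis (Re (c * z)) \<partial>cgauss) = exp (- (cmod c)\<^sup>2 / 4)"
proof -
  define N where "N = density lborel (normal_density 0 (sqrt (1/2)))"
  interpret N: prob_space N
    unfolding N_def by (rule prob_space_normal_density) simp
  interpret NN: pair_prob_space N N ..
  have sN [measurable_cong]: "sets N = sets borel"
    by (simp add: N_def)
  have [measurable]: "(\<lambda>(x, y). Complex x y) \<in> N \<Otimes>\<^sub>M N \<rightarrow>\<^sub>M borel"
    unfolding Complex_eq by measurable
  have "(\<integral>z. cis (Re (c * z)) \<partial>cgauss)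
      = (\<integral>p. cis (Re c * fst p) * cis (- Im c * snd p) \<partial>(N \<Otimes>\<^sub>M N))"
    unfolding distr_normal_cgauss[folded N_def, symmetric]
    by (subst integral_distr) (auto simp: split_beta' cis_mult cis_conv_exp exp_add[symmetric] algebra_simps)
  also have "\<dots> = (\<integral>x. (\<integral>y. cis (Re c * x) * cis (- Im c * y) \<partial>N) \<partial>N)"
    by (subst NN.integral_fst'[symmetric])
       (auto intro!: NN.integrable_const_bound[where B=1] simp: norm_mult cis_conv_exp)
  also have "\<dots> = exp (- (Re c)\<^sup>2 / 4) * exp (- (Im c)\<^sup>2 / 4)"
    using normal_half_char[folded N_def, of "Re c"] normal_half_char[folded N_def, of "- Im c"]
    by simp
  also have "\<dots> = exp (- (cmod c)\<^sup>2 / 4)"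
    unfolding cmod_power2 by (simp add: exp_add[symmetric] of_real_mult[symmetric] field_simps
        del: of_real_mult)
  finally show ?thesis .
qed

lemma nn_integral_lborel_complex_affine:
  fixes f :: "complex \<Rightarrow> ennreal"
  assumes [measurable]: "f \<in> borel_measurable borel" and "c \<noteq> 0"
  shows "(\<integral>\<^sup>+z. f z \<partial>lborel) = ennreal (c\<^sup>2) * (\<integral>\<^sup>+z. f (t + of_real c * z) \<partial>lborel)"
proof -
  have "(\<integral>\<^sup>+z. f z \<partial>lborel)
      = (\<integral>\<^sup>+z. f z \<partial>density (distr lborel borel (\<lambda>x. t + c *\<^sub>R x)) (\<lambda>_. \<bar>c\<bar>^DIM(complex)))"
    using lborel_affine[OF \<open>c \<noteq> 0\<close>, of t] by simp
  also have "\<dots> = ennreal (c\<^sup>2) * (\<integral>\<^sup>+z. f (t + of_real c * z) \<partial>lborel)"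
    by (simp add: nn_integral_density nn_integral_distr nn_integral_cmult scaleR_conv_of_real
        power2_eq_square power_abs flip: power2_abs)
  finally show ?thesis .
qed

lemma nn_integral_cgauss:
  assumes [measurable]: "f \<in> borel_measurable borel"
  shows "(\<integral>\<^sup>+z. f z \<partial>cgauss) = (\<integral>\<^sup>+z. ennreal (exp (- (cmod z)\<^sup>2) / pi) * f z \<partial>lborel)"
  unfolding cgauss_def by (subst nn_integral_density) auto

text \<open>The substitutions \<open>z = (p - b w) / a\<close> and then \<open>w = a q + cnj b p\<close> have reciprocal Jacobians.\<close>

lemma cgauss_rotation:
  assumes ab: "a > 0" "a\<^sup>2 + (cmod b)\<^sup>2 = 1"
    and [measurable]: "case_prod f \<in> borel_measurable (borel \<Otimes>\<^sub>M borel)"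
  shows "(\<integral>\<^sup>+z. \<integral>\<^sup>+w. f (of_real a * z + b * w) (of_real a * w - cnj b * z) \<partial>cgauss \<partial>cgauss)
       = (\<integral>\<^sup>+z. \<integral>\<^sup>+w. f z w \<partial>cgauss \<partial>cgauss)"
proof -
  define d where "d z w = ennreal (exp (- (cmod z)\<^sup>2) / pi) * ennreal (exp (- (cmod w)\<^sup>2) / pi)"
    for z w :: complex
  have [measurable]: "case_prod d \<in> borel_measurable (borel \<Otimes>\<^sub>M borel)"
    unfolding d_def by measurable
  have [measurable]: "(\<lambda>x. f (h x) (k x)) \<in> borel_measurable M"
    "(\<lambda>x. d (h x) (k x)) \<in> borel_measurable M"
    if [measurable]: "h \<in> borel_measurable M" "k \<in> borel_measurable M" for h k M
    using measurable_compose[of "\<lambda>x. (h x, k x)" M, OF _ assms(3)]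
    by (auto simp: d_def)
  have as_lborel: "(\<integral>\<^sup>+z. \<integral>\<^sup>+w. F z w \<partial>cgauss \<partial>cgauss)
      = (\<integral>\<^sup>+z. \<integral>\<^sup>+w. d z w * F z w \<partial>lborel \<partial>lborel)"
    if F [measurable]: "case_prod F \<in> borel_measurable (borel \<Otimes>\<^sub>M borel)" for F
  proof -
    have "(\<integral>\<^sup>+z. \<integral>\<^sup>+w. F z w \<partial>cgauss \<partial>cgauss) = (\<integral>\<^sup>+z. ennreal (exp (- (cmod z)\<^sup>2) / pi) *
        (\<integral>\<^sup>+w. ennreal (exp (- (cmod w)\<^sup>2) / pi) * F z w \<partial>lborel) \<partial>lborel)"
      by (subst nn_integral_cgauss) (auto intro!: nn_integral_cong simp: nn_integral_cgauss)
    then show ?thesis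
      by (simp add: d_def nn_integral_cmult mult.assoc)
  qed
  have dd: "d z w = ennreal (exp (- ((cmod z)\<^sup>2 + (cmod w)\<^sup>2)) / pi\<^sup>2)" for z w
    by (simp add: d_def ennreal_mult[symmetric] exp_diff exp_minus power2_eq_square field_simps)
  have a: "complex_of_real a * complex_of_real a + b * cnj b = 1"
  proof -
    have "complex_of_real a * complex_of_real a + b * cnj b = complex_of_real (a\<^sup>2 + (cmod b)\<^sup>2)"
      unfolding of_real_add complex_norm_square by (simp add: power2_eq_square)
    then show ?thesis
      by (simp add: ab(2))
  qed
  have inv: "d (of_real a * z + b * w) (of_real a * w - cnj b * z) = d z w" for z w
  proof -
    have "complex_of_real ((cmod (of_real a * z + b * w))\<^sup>2 + (cmod (of_real a * w - cnj b * z))\<^sup>2)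
        = (of_real a * of_real a + b * cnj b) * (z * cnj z + w * cnj w)"
      unfolding of_real_add complex_norm_square by (simp add: algebra_simps)
    then have "complex_of_real ((cmod (of_real a * z + b * w))\<^sup>2 +
        (cmod (of_real a * w - cnj b * z))\<^sup>2) = complex_of_real ((cmod z)\<^sup>2 + (cmod w)\<^sup>2)"
      by (simp only: a mult_1 of_real_add complex_norm_square)
    then have "(cmod (of_real a * z + b * w))\<^sup>2 + (cmod (of_real a * w - cnj b * z))\<^sup>2
        = (cmod z)\<^sup>2 + (cmod w)\<^sup>2"
      unfolding of_real_eq_iff .
    then show ?thesis
      unfolding dd by simp
  qed
  have "(\<integral>\<^sup>+z. \<integral>\<^sup>+w. f (of_real a * z + b * w) (of_real a * w - cnj b * z) \<partial>cgauss \<partial>cgauss)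
      = (\<integral>\<^sup>+z. \<integral>\<^sup>+w. d (of_real a * z + b * w) (of_real a * w - cnj b * z) *
           f (of_real a * z + b * w) (of_real a * w - cnj b * z) \<partial>lborel \<partial>lborel)"
    by (subst as_lborel) (auto simp: inv)
  also have "\<dots> = (\<integral>\<^sup>+w. \<integral>\<^sup>+z. d (of_real a * z + b * w) (of_real a * w - cnj b * z) *
           f (of_real a * z + b * w) (of_real a * w - cnj b * z) \<partial>lborel \<partial>lborel)"
    by (rule lborel_pair.Fubini') simp
  also have "\<dots> = (\<integral>\<^sup>+w. ennreal ((1/a)\<^sup>2) * (\<integral>\<^sup>+p. d p (w / of_real a - cnj b * p / of_real a) *
           f p (w / of_real a - cnj b * p / of_real a) \<partial>lborel) \<partial>lborel)"
  proof (intro nn_integral_cong)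
    fix w
    have 1: "of_real a * (- (b * w) / of_real a + of_real (1/a) * p) + b * w = p" for p
      using ab by (simp add: field_simps)
    have 2: "of_real a * w - cnj b * (- (b * w) / of_real a + of_real (1/a) * p)
        = w / of_real a - cnj b * p / of_real a" for p
    proof -
      have "of_real a * w - cnj b * (- (b * w) / of_real a + of_real (1/a) * p)
          = ((of_real a * of_real a + b * cnj b) * w - cnj b * p) / of_real a"
        using ab by (simp add: field_simps)
      then show ?thesis
        unfolding a by (simp add: diff_divide_distrib)
    qed
    show "(\<integral>\<^sup>+z. d (of_real a * z + b * w) (of_real a * w - cnj b * z) *
           f (of_real a * z + b * w) (of_real a * w - cnj b * z) \<partial>lborel)
        = ennreal ((1/a)\<^sup>2) * (\<integral>\<^sup>+p. d p (w / of_real a - cnj b * p / of_real a) *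
           f p (w / of_real a - cnj b * p / of_real a) \<partial>lborel)"
      using ab nn_integral_lborel_complex_affine[where c="1/a" and t="- (b * w) / of_real a" and
        f="\<lambda>z. d (of_real a * z + b * w) (of_real a * w - cnj b * z) *
           f (of_real a * z + b * w) (of_real a * w - cnj b * z)"]
      unfolding 1 2 by simp
  qed
  also have "\<dots> = ennreal ((1/a)\<^sup>2) * (\<integral>\<^sup>+w. \<integral>\<^sup>+p. d p (w / of_real a - cnj b * p / of_real a) *
           f p (w / of_real a - cnj b * p / of_real a) \<partial>lborel \<partial>lborel)"
    by (rule nn_integral_cmult) simp
  also have "(\<integral>\<^sup>+w. \<integral>\<^sup>+p. d p (w / of_real a - cnj b * p / of_real a) *
           f p (w / of_real a - cnj b * p / of_real a) \<partial>lborel \<partial>lborel)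
      = (\<integral>\<^sup>+p. \<integral>\<^sup>+w. d p (w / of_real a - cnj b * p / of_real a) *
           f p (w / of_real a - cnj b * p / of_real a) \<partial>lborel \<partial>lborel)"
    by (rule lborel_pair.Fubini') simp
  also have "\<dots> = (\<integral>\<^sup>+p. ennreal (a\<^sup>2) * (\<integral>\<^sup>+q. d p q * f p q \<partial>lborel) \<partial>lborel)"
  proof (intro nn_integral_cong)
    fix p
    have 1: "(cnj b * p + of_real a * q) / of_real a - cnj b * p / of_real a = q" for q
      using ab by (simp add: field_simps)
    show "(\<integral>\<^sup>+w. d p (w / of_real a - cnj b * p / of_real a) *
           f p (w / of_real a - cnj b * p / of_real a) \<partial>lborel)
        = ennreal (a\<^sup>2) * (\<integral>\<^sup>+q. d p q * f p q \<partial>lborel)"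
      using ab nn_integral_lborel_complex_affine[where c=a and t="cnj b * p" and
        f="\<lambda>w. d p (w / of_real a - cnj b * p / of_real a) *
           f p (w / of_real a - cnj b * p / of_real a)"]
      unfolding 1 by simp
  qed
  also have "\<dots> = ennreal (a\<^sup>2) * (\<integral>\<^sup>+p. \<integral>\<^sup>+q. d p q * f p q \<partial>lborel \<partial>lborel)"
    by (rule nn_integral_cmult) simp
  also have "ennreal ((1/a)\<^sup>2) * \<dots> = (\<integral>\<^sup>+z. \<integral>\<^sup>+w. f z w \<partial>cgauss \<partial>cgauss)"
    using ab by (simp add: mult.assoc[symmetric] ennreal_mult[symmetric] as_lborel power_divide)
  finally show ?thesis .
qed

lemma nn_integral_cgauss_exp:
  assumes "s \<ge> 0"
  shows "(\<integral>\<^sup>+z. ennreal (exp (- (s * (cmod z)\<^sup>2))) \<partial>cgauss) = ennreal (1 / (1 + s))"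
proof -
  define c where "c = 1 / sqrt (1 + s)"
  have c: "c > 0" "c\<^sup>2 = 1 / (1 + s)"
    using assms by (auto simp: c_def power_divide)
  have "(\<integral>\<^sup>+z. ennreal (exp (- (s * (cmod z)\<^sup>2))) \<partial>cgauss)
      = (\<integral>\<^sup>+z. ennreal (exp (- ((1 + s) * (cmod z)\<^sup>2)) / pi) \<partial>lborel)"
    by (subst nn_integral_cgauss)
      (auto simp: ennreal_mult[symmetric] exp_add[symmetric] algebra_simps)
  also have "\<dots> = ennreal (c\<^sup>2) * (\<integral>\<^sup>+z. ennreal (exp (- ((cmod z)\<^sup>2)) / pi) \<partial>lborel)"
    using c assms by (subst nn_integral_lborel_complex_affine[where c=c and t=0])
      (auto simp: norm_mult power_mult_distrib)
  also have "(\<integral>\<^sup>+z. ennreal (exp (- ((cmod z)\<^sup>2)) / pi) \<partial>lborel) = 1"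
    using cgauss.emeasure_space_1 nn_integral_cgauss[of "\<lambda>_. 1"] by simp
  finally show ?thesis
    using c by simp
qed

section \<open>Rotations of Gaussian vectors\<close>

interpretation cgauss_prod: product_sigma_finite "\<lambda>_. cgauss"
  by unfold_locales

abbreviation cgauss_vec :: "'i set \<Rightarrow> ('i \<Rightarrow> complex) measure" where
  "cgauss_vec I \<equiv> Pi\<^sub>M I (\<lambda>_. cgauss)"

lemma prob_space_cgauss_vec: "prob_space (cgauss_vec I)"
  by (intro prob_space_PiM cgauss.prob_space_axioms)

lemma pair_prob_space_cgauss_vec: "pair_prob_space (cgauss_vec I) (cgauss_vec J)"
  by (simp add: pair_prob_space_def pair_sigma_finite_def prob_space_cgauss_vec
      prob_space_imp_sigma_finite)

definition rotate_pair ::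
    "'i set \<Rightarrow> real \<Rightarrow> complex \<Rightarrow> ('i \<Rightarrow> complex) \<times> ('i \<Rightarrow> complex) \<Rightarrow> ('i \<Rightarrow> complex) \<times> ('i \<Rightarrow> complex)"
  where "rotate_pair I a b = (\<lambda>(x, y).
    (\<lambda>i\<in>I. of_real a * x i + b * y i, \<lambda>i\<in>I. of_real a * y i - cnj b * x i))"

lemma measurable_rotate_pair [measurable]:
  "rotate_pair I a b \<in> cgauss_vec I \<Otimes>\<^sub>M cgauss_vec I \<rightarrow>\<^sub>M cgauss_vec I \<Otimes>\<^sub>M cgauss_vec I"
  unfolding rotate_pair_def by measurable

lemma nn_integral_rotate_pair:
  assumes "finite I" and ab: "a > 0" "a\<^sup>2 + (cmod b)\<^sup>2 = 1"
    and "F \<in> borel_measurable (cgauss_vec I \<Otimes>\<^sub>M cgauss_vec I)"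
  shows "(\<integral>\<^sup>+x. \<integral>\<^sup>+y. F (rotate_pair I a b (x, y)) \<partial>cgauss_vec I \<partial>cgauss_vec I)
       = (\<integral>\<^sup>+x. \<integral>\<^sup>+y. F (x, y) \<partial>cgauss_vec I \<partial>cgauss_vec I)"
  using assms(1,4)
proof (induction I arbitrary: F)
  case empty
  have "rotate_pair {} a b (x, y) = (x, y)"
    if "x \<in> space (cgauss_vec {})" "y \<in> space (cgauss_vec {})" for x y :: "'a \<Rightarrow> complex"
    using that by (simp add: space_PiM rotate_pair_def restrict_def)
  then show ?case
    by (intro nn_integral_cong) simp
next
  case (insert i I)
  let ?G = "cgauss_vec I" and ?G' = "cgauss_vec (insert i I)"
  interpret G: prob_space ?G
    by (rule prob_space_cgauss_vec)
  interpret cG: pair_prob_space cgauss ?G ..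
  have split: "(\<integral>\<^sup>+x. \<integral>\<^sup>+y. H (x, y) \<partial>?G' \<partial>?G')
      = (\<integral>\<^sup>+x. \<integral>\<^sup>+y. \<integral>\<^sup>+z. \<integral>\<^sup>+w. H (x(i := z), y(i := w)) \<partial>cgauss \<partial>cgauss \<partial>?G \<partial>?G)"
    if [measurable]: "H \<in> borel_measurable (?G' \<Otimes>\<^sub>M ?G')" for H
  proof -
    interpret G': prob_space ?G'
      by (rule prob_space_cgauss_vec)
    have "(\<integral>\<^sup>+x. \<integral>\<^sup>+y. H (x, y) \<partial>?G' \<partial>?G')
        = (\<integral>\<^sup>+x. \<integral>\<^sup>+z. \<integral>\<^sup>+y. H (x(i := z), y) \<partial>?G' \<partial>cgauss \<partial>?G)"
      by (subst cgauss_prod.product_nn_integral_insert[OF insert.hyps]) simp_all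
    also have "\<dots> = (\<integral>\<^sup>+x. \<integral>\<^sup>+z. \<integral>\<^sup>+y. \<integral>\<^sup>+w. H (x(i := z), y(i := w)) \<partial>cgauss \<partial>?G \<partial>cgauss \<partial>?G)"
    proof (intro nn_integral_cong)
      fix x z assume x: "x \<in> space ?G"
      then have [measurable]: "(\<lambda>_. x(i := z)) \<in> N \<rightarrow>\<^sub>M ?G'" for N :: "('a \<Rightarrow> complex) measure"
        by (intro measurable_const) (auto simp: space_PiM PiE_def extensional_def)
      show "(\<integral>\<^sup>+y. H (x(i := z), y) \<partial>?G')
          = (\<integral>\<^sup>+y. \<integral>\<^sup>+w. H (x(i := z), y(i := w)) \<partial>cgauss \<partial>?G)"
        by (subst cgauss_prod.product_nn_integral_insert[OF insert.hyps]) simp_all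
    qed
    also have "\<dots> = (\<integral>\<^sup>+x. \<integral>\<^sup>+y. \<integral>\<^sup>+z. \<integral>\<^sup>+w. H (x(i := z), y(i := w)) \<partial>cgauss \<partial>cgauss \<partial>?G \<partial>?G)"
    proof (intro nn_integral_cong)
      fix x assume x: "x \<in> space ?G"
      then have [measurable]: "(\<lambda>p. x(i := f p)) \<in> N \<rightarrow>\<^sub>M ?G'" if "f \<in> N \<rightarrow>\<^sub>M cgauss"
        for N :: "(complex \<times> (('a \<Rightarrow> complex) \<times> complex)) measure" and f
        using that by (intro measurable_fun_upd[where J=I]) auto
      have [measurable]: "(\<lambda>p. x(i := f p)) \<in> N \<rightarrow>\<^sub>M ?G'" if "f \<in> N \<rightarrow>\<^sub>M cgauss"
        for N :: "((complex \<times> ('a \<Rightarrow> complex)) \<times> complex) measure" and f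
        using that x by (intro measurable_fun_upd[where J=I]) auto
      show "(\<integral>\<^sup>+z. \<integral>\<^sup>+y. \<integral>\<^sup>+w. H (x(i := z), y(i := w)) \<partial>cgauss \<partial>?G \<partial>cgauss)
          = (\<integral>\<^sup>+y. \<integral>\<^sup>+z. \<integral>\<^sup>+w. H (x(i := z), y(i := w)) \<partial>cgauss \<partial>cgauss \<partial>?G)"
        by (rule cG.Fubini'[symmetric]) measurable
    qed
    finally show ?thesis .
  qed
  note insert.prems [measurable]
  have "(\<integral>\<^sup>+x. \<integral>\<^sup>+y. F (rotate_pair (insert i I) a b (x, y)) \<partial>?G' \<partial>?G')
      = (\<integral>\<^sup>+x. \<integral>\<^sup>+y. \<integral>\<^sup>+z. \<integral>\<^sup>+w. F (rotate_pair (insert i I) a b (x(i := z), y(i := w)))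
          \<partial>cgauss \<partial>cgauss \<partial>?G \<partial>?G)"
    by (rule split) measurable
  also have "\<dots> = (\<integral>\<^sup>+x. \<integral>\<^sup>+y. (\<lambda>(x, y). \<integral>\<^sup>+z. \<integral>\<^sup>+w. F (x(i := z), y(i := w)) \<partial>cgauss \<partial>cgauss)
      (rotate_pair I a b (x, y)) \<partial>?G \<partial>?G)"
  proof (intro nn_integral_cong)
    fix x y :: "'a \<Rightarrow> complex"
    define u v where "u = fst (rotate_pair I a b (x, y))" and "v = snd (rotate_pair I a b (x, y))"
    have uv: "u \<in> space ?G" "v \<in> space ?G"
      by (auto simp: u_def v_def rotate_pair_def space_PiM)
    have "rotate_pair (insert i I) a b (x(i := z), y(i := w))
        = (u(i := of_real a * z + b * w), v(i := of_real a * w - cnj b * z))" for z w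
      using insert.hyps by (auto simp: u_def v_def rotate_pair_def fun_eq_iff)
    moreover have "(\<integral>\<^sup>+z. \<integral>\<^sup>+w. F (u(i := of_real a * z + b * w), v(i := of_real a * w - cnj b * z))
        \<partial>cgauss \<partial>cgauss) = (\<integral>\<^sup>+z. \<integral>\<^sup>+w. F (u(i := z), v(i := w)) \<partial>cgauss \<partial>cgauss)"
    proof (rule cgauss_rotation[OF ab])
      have [measurable]: "(\<lambda>p. u(i := fst p)) \<in> borel \<Otimes>\<^sub>M borel \<rightarrow>\<^sub>M ?G'"
        "(\<lambda>p. v(i := snd p)) \<in> borel \<Otimes>\<^sub>M borel \<rightarrow>\<^sub>M ?G'"
        using uv by (auto intro!: measurable_fun_upd[where J=I])
      show "(\<lambda>(z, w). F (u(i := z), v(i := w))) \<in> borel_measurable (borel \<Otimes>\<^sub>M borel)"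
        unfolding split_beta' by measurable
    qed
    ultimately show "(\<integral>\<^sup>+z. \<integral>\<^sup>+w. F (rotate_pair (insert i I) a b (x(i := z), y(i := w)))
        \<partial>cgauss \<partial>cgauss) = (\<lambda>(x, y). \<integral>\<^sup>+z. \<integral>\<^sup>+w. F (x(i := z), y(i := w)) \<partial>cgauss \<partial>cgauss)
        (rotate_pair I a b (x, y))"
      by (simp add: u_def v_def split_beta')
  qed
  also have "\<dots> = (\<integral>\<^sup>+x. \<integral>\<^sup>+y. (\<lambda>(x, y). \<integral>\<^sup>+z. \<integral>\<^sup>+w. F (x(i := z), y(i := w)) \<partial>cgauss \<partial>cgauss)
      (x, y) \<partial>?G \<partial>?G)"
    by (rule insert.IH) measurable
  also have "\<dots> = (\<integral>\<^sup>+x. \<integral>\<^sup>+y. F (x, y) \<partial>?G' \<partial>?G')"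
    by (simp add: split)
  finally show ?case .
qed

lemma distr_rotate_pair:
  assumes "finite I" "a > 0" "a\<^sup>2 + (cmod b)\<^sup>2 = 1"
  shows "distr (cgauss_vec I \<Otimes>\<^sub>M cgauss_vec I) (cgauss_vec I \<Otimes>\<^sub>M cgauss_vec I) (rotate_pair I a b)
       = cgauss_vec I \<Otimes>\<^sub>M cgauss_vec I"
proof (rule measure_eqI)
  interpret G: prob_space "cgauss_vec I"
    by (rule prob_space_cgauss_vec)
  fix A assume "A \<in> sets (distr (cgauss_vec I \<Otimes>\<^sub>M cgauss_vec I) (cgauss_vec I \<Otimes>\<^sub>M cgauss_vec I)
    (rotate_pair I a b))"
  then have [measurable]: "A \<in> sets (cgauss_vec I \<Otimes>\<^sub>M cgauss_vec I)"
    by simp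
  have "emeasure (distr (cgauss_vec I \<Otimes>\<^sub>M cgauss_vec I) (cgauss_vec I \<Otimes>\<^sub>M cgauss_vec I)
      (rotate_pair I a b)) A
      = (\<integral>\<^sup>+p. indicator A (rotate_pair I a b p) \<partial>(cgauss_vec I \<Otimes>\<^sub>M cgauss_vec I))"
    by (subst nn_integral_indicator[symmetric], simp, subst nn_integral_distr) simp_all
  also have "\<dots> = (\<integral>\<^sup>+x. \<integral>\<^sup>+y. indicator A (rotate_pair I a b (x, y)) \<partial>cgauss_vec I \<partial>cgauss_vec I)"
    by (subst G.nn_integral_fst[symmetric]) simp_all
  also have "\<dots> = (\<integral>\<^sup>+x. \<integral>\<^sup>+y. indicator A (x, y) \<partial>cgauss_vec I \<partial>cgauss_vec I)"
    by (rule nn_integral_rotate_pair[OF assms]) simp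
  also have "\<dots> = (\<integral>\<^sup>+p. indicator A p \<partial>(cgauss_vec I \<Otimes>\<^sub>M cgauss_vec I))"
    by (subst G.nn_integral_fst[symmetric]) simp_all
  finally show "emeasure (distr (cgauss_vec I \<Otimes>\<^sub>M cgauss_vec I) (cgauss_vec I \<Otimes>\<^sub>M cgauss_vec I)
      (rotate_pair I a b)) A = emeasure (cgauss_vec I \<Otimes>\<^sub>M cgauss_vec I) A"
    by simp
qed simp

lemma integral_rotate_pair:
  fixes f :: "_ \<Rightarrow> complex"
  assumes "finite I" "a > 0" "a\<^sup>2 + (cmod b)\<^sup>2 = 1"
    and "f \<in> borel_measurable (cgauss_vec I \<Otimes>\<^sub>M cgauss_vec I)"
  shows "(\<integral>p. f (rotate_pair I a b p) \<partial>(cgauss_vec I \<Otimes>\<^sub>M cgauss_vec I))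
       = (\<integral>p. f p \<partial>(cgauss_vec I \<Otimes>\<^sub>M cgauss_vec I))"
  using integral_distr[of "rotate_pair I a b" "cgauss_vec I \<Otimes>\<^sub>M cgauss_vec I"
      "cgauss_vec I \<Otimes>\<^sub>M cgauss_vec I" f] assms(4)
  by (simp add: distr_rotate_pair[OF assms(1-3)])

lemma measurable_cis [measurable]:
  "f \<in> borel_measurable M \<Longrightarrow> (\<lambda>x. cis (f x)) \<in> borel_measurable M"
  unfolding cis_conv_exp by measurable

lemma cis_sum: "finite I \<Longrightarrow> cis (\<Sum>i\<in>I. f i) = (\<Prod>i\<in>I. cis (f i))"
  by (induction I rule: finite_induct) (simp_all flip: cis_mult)

lemma cgauss_vec_char:
  assumes "finite I"
  shows "(\<integral>x. cis (Re (\<Sum>i\<in>I. c i * x i)) \<partial>cgauss_vec I)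
       = of_real (exp (- (\<Sum>i\<in>I. (cmod (c i))\<^sup>2) / 4))"
proof -
  have "(\<integral>x. cis (Re (\<Sum>i\<in>I. c i * x i)) \<partial>cgauss_vec I)
      = (\<integral>x. (\<Prod>i\<in>I. cis (Re (c i * x i))) \<partial>cgauss_vec I)"
    by (simp only: Re_sum cis_sum[OF assms])
  also have "\<dots> = (\<Prod>i\<in>I. \<integral>z. cis (Re (c i * z)) \<partial>cgauss)"
    by (rule cgauss_prod.product_integral_prod[OF assms])
      (intro cgauss.integrable_const_bound[where B=1], simp_all)
  also have "\<dots> = of_real (exp (- (\<Sum>i\<in>I. (cmod (c i))\<^sup>2) / 4))"
    unfolding cgauss_char
    by (simp add: exp_sum[OF assms] sum_negf[symmetric] sum_divide_distrib)
  finally show ?thesis .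
qed

lemma cgauss_vec_nn_integral_exp:
  assumes "finite I" "s \<ge> 0"
  shows "(\<integral>\<^sup>+x. ennreal (exp (- (s * (\<Sum>i\<in>I. (cmod (x i))\<^sup>2)))) \<partial>cgauss_vec I)
       = ennreal (1 / (1 + s) ^ card I)"
proof -
  have "(\<integral>\<^sup>+x. ennreal (exp (- (s * (\<Sum>i\<in>I. (cmod (x i))\<^sup>2)))) \<partial>cgauss_vec I)
      = (\<integral>\<^sup>+x. (\<Prod>i\<in>I. ennreal (exp (- (s * (cmod (x i))\<^sup>2)))) \<partial>cgauss_vec I)"
    by (simp add: prod_ennreal exp_sum[OF assms(1), symmetric] sum_distrib_left sum_negf)
  also have "\<dots> = (\<Prod>i\<in>I. \<integral>\<^sup>+z. ennreal (exp (- (s * (cmod z)\<^sup>2))) \<partial>cgauss)"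
    by (rule cgauss_prod.product_nn_integral_prod[OF assms(1)]) simp
  also have "\<dots> = ennreal (1 / (1 + s) ^ card I)"
    using assms by (simp add: nn_integral_cgauss_exp ennreal_power power_divide)
  finally show ?thesis .
qed

section \<open>Characteristic functions of symmetric bilinear forms\<close>

lemma parallelogram:
  fixes u v :: complex
  defines "s \<equiv> of_real (1 / sqrt 2)"
  shows "(cmod (s * (u + v) + w))\<^sup>2 + (cmod (s * (v - u) + w))\<^sup>2
       = (cmod u)\<^sup>2 + (cmod (v + of_real (sqrt 2) * w))\<^sup>2"
proof -
  have *: "(cmod (p + q))\<^sup>2 + (cmod (p - q))\<^sup>2 = 2 * (cmod p)\<^sup>2 + 2 * (cmod q)\<^sup>2" for p q :: complex
    by (simp only: cmod_power2) (simp add: power2_eq_square algebra_simps)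
  have "s * (of_real (sqrt 2) * w) = w"
    by (simp add: s_def)
  then have 1: "s * (u + v) + w = s * (v + of_real (sqrt 2) * w) + s * u"
    "s * (v - u) + w = s * (v + of_real (sqrt 2) * w) - s * u"
    by (simp_all add: algebra_simps)
  have s2: "(cmod s)\<^sup>2 = 1 / 2"
    by (simp add: s_def norm_divide power_divide)
  show ?thesis
    unfolding 1 * norm_mult power_mult_distrib s2 by simp
qed

text \<open>The phase of the first argument is kept, so that the merged coefficient is obtained from
  \<open>(g\<^sub>1, g\<^sub>2)\<close> by a unitary map of the form handled by \<^const>\<open>rotate_pair\<close>.\<close>

definition merge_coeff :: "complex \<Rightarrow> complex \<Rightarrow> complex" where
  "merge_coeff g1 g2 =
     (if g1 = 0 then g2 else sgn g1 * of_real (sqrt ((cmod g1)\<^sup>2 + (cmod g2)\<^sup>2)))"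

lemma cmod_merge_coeff: "(cmod (merge_coeff g1 g2))\<^sup>2 = (cmod g1)\<^sup>2 + (cmod g2)\<^sup>2"
  by (simp add: merge_coeff_def norm_mult norm_sgn)

locale symmetric_form =
  fixes I :: "'i set" and S :: "'i \<Rightarrow> 'i \<Rightarrow> complex" and t :: "'i \<Rightarrow> complex"
  assumes finite_index: "finite I"
    and symmetric: "k \<in> I \<Longrightarrow> l \<in> I \<Longrightarrow> S k l = S l k"
begin

sublocale V: prob_space "cgauss_vec I"
  by (rule prob_space_cgauss_vec)

sublocale VV: pair_prob_space "cgauss_vec I" "cgauss_vec I"
  by (rule pair_prob_space_cgauss_vec)

definition lin :: "('i \<Rightarrow> complex) \<Rightarrow> complex" where
  "lin x = (\<Sum>k\<in>I. t k * x k)"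

definition form :: "('i \<Rightarrow> complex) \<Rightarrow> ('i \<Rightarrow> complex) \<Rightarrow> complex" where
  "form x y = (\<Sum>k\<in>I. \<Sum>l\<in>I. x k * S k l * y l)"

definition row :: "('i \<Rightarrow> complex) \<Rightarrow> 'i \<Rightarrow> complex" where
  "row x l = (\<Sum>k\<in>I. x k * S k l)"

definition nrm2 :: "complex \<Rightarrow> ('i \<Rightarrow> complex) \<Rightarrow> real" where
  "nrm2 g x = (\<Sum>l\<in>I. (cmod (row x l + g * t l))\<^sup>2)"

definition \<Phi> :: "complex \<Rightarrow> complex \<Rightarrow> complex" where
  "\<Phi> g1 g2 = (\<integral>x. (\<integral>y. cis (Re (form x y + g1 * lin y + g2 * lin x)) \<partial>cgauss_vec I) \<partial>cgauss_vec I)"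

lemma measurable_lin [measurable]: "lin \<in> borel_measurable (cgauss_vec I)"
  unfolding lin_def by measurable

lemma measurable_row [measurable]: "l \<in> I \<Longrightarrow> (\<lambda>x. row x l) \<in> borel_measurable (cgauss_vec I)"
  unfolding row_def by measurable

lemma measurable_nrm2 [measurable]: "nrm2 g \<in> borel_measurable (cgauss_vec I)"
  unfolding nrm2_def by measurable

lemma measurable_form [measurable]:
  "(\<lambda>p. form (fst p) (snd p)) \<in> borel_measurable (cgauss_vec I \<Otimes>\<^sub>M cgauss_vec I)"
  unfolding form_def by measurable

lemma nrm2_nonneg: "nrm2 g x \<ge> 0"
  by (simp add: nrm2_def sum_nonneg)

lemma form_sym: "form x y = form y x"
  unfolding form_def by (subst sum.swap) (auto intro!: sum.cong simp: symmetric mult_ac)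

lemma form_row: "form x y = (\<Sum>l\<in>I. row x l * y l)"
  unfolding form_def row_def by (subst sum.swap) (simp add: sum_distrib_right)

lemma inner_char:
  "(\<integral>y. cis (Re (form x y + g * lin y)) \<partial>cgauss_vec I) = of_real (exp (- nrm2 g x / 4))"
  using cgauss_vec_char[OF finite_index, of "\<lambda>l. row x l + g * t l"]
  by (simp add: form_row lin_def nrm2_def sum_distrib_left sum.distrib ring_distribs mult.assoc
      del: plus_complex.sel times_complex.sel Re_sum)

lemma \<Phi>_eq: "\<Phi> g1 g2 = (\<integral>x. cis (Re (g2 * lin x)) * of_real (exp (- nrm2 g1 x / 4)) \<partial>cgauss_vec I)"
  unfolding \<Phi>_def
proof (rule Bochner_Integration.integral_cong[OF refl])
  fix x
  have "cis (Re (form x y + g1 * lin y + g2 * lin x))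
      = cis (Re (g2 * lin x)) * cis (Re (form x y + g1 * lin y))" for y
    by (simp add: cis_mult add.commute del: times_complex.sel)
  then show "(\<integral>y. cis (Re (form x y + g1 * lin y + g2 * lin x)) \<partial>cgauss_vec I)
      = cis (Re (g2 * lin x)) * of_real (exp (- nrm2 g1 x / 4))"
    by (simp add: inner_char del: times_complex.sel plus_complex.sel)
qed

lemma \<Phi>_swap: "\<Phi> g 0 = \<Phi> 0 g"
proof -
  have "\<Phi> g 0 = (\<integral>y. (\<integral>x. cis (Re (form x y + g * lin y)) \<partial>cgauss_vec I) \<partial>cgauss_vec I)"
    unfolding \<Phi>_def mult_zero_left add_0_right
  proof (rule VV.Fubini_integral[symmetric])
    show "integrable (cgauss_vec I \<Otimes>\<^sub>M cgauss_vec I) (\<lambda>(x, y). cis (Re (form x y + g * lin y)))"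
      unfolding split_beta' by (intro VV.integrable_const_bound[where B=1]) simp_all
  qed
  then show ?thesis
    unfolding \<Phi>_def by (simp add: form_sym del: times_complex.sel plus_complex.sel)
qed

lemma \<Phi>_pos_real: "\<Phi> 0 g = of_real (cmod (\<Phi> 0 g))"
proof -
  have "\<Phi> 0 g = \<Phi> g 0"
    by (rule \<Phi>_swap[symmetric])
  also have "\<dots> = (\<integral>x. complex_of_real (exp (- nrm2 g x / 4)) \<partial>cgauss_vec I)"
    unfolding \<Phi>_eq mult_zero_left zero_complex.sel cis_zero mult_1 ..
  also have "\<dots> = of_real (\<integral>x. exp (- nrm2 g x / 4) \<partial>cgauss_vec I)"
    by (rule integral_complex_of_real)
  finally have "\<Phi> 0 g = of_real (\<integral>x. exp (- nrm2 g x / 4) \<partial>cgauss_vec I)" .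
  moreover have "(\<integral>x. exp (- nrm2 g x / 4) \<partial>cgauss_vec I) \<ge> 0"
    by (rule Bochner_Integration.integral_nonneg) simp
  ultimately show ?thesis
    by simp
qed

lemma integral_mult_pair:
  fixes f h :: "('i \<Rightarrow> complex) \<Rightarrow> complex"
  assumes [measurable]: "f \<in> borel_measurable (cgauss_vec I)" "h \<in> borel_measurable (cgauss_vec I)"
    and bnd: "\<And>x. cmod (f x) \<le> 1" "\<And>x. cmod (h x) \<le> 1"
  shows "(\<integral>p. f (fst p) * h (snd p) \<partial>(cgauss_vec I \<Otimes>\<^sub>M cgauss_vec I))
       = (\<integral>x. f x \<partial>cgauss_vec I) * (\<integral>x. h x \<partial>cgauss_vec I)"
proof -
  have "integrable (cgauss_vec I \<Otimes>\<^sub>M cgauss_vec I) (\<lambda>p. f (fst p) * h (snd p))"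
    by (intro VV.integrable_const_bound[where B=1])
      (auto simp: norm_mult intro!: AE_I2 mult_le_one bnd)
  from VV.integral_fst'[OF this] show ?thesis
    by simp
qed

lemma lin_rotate:
  "lin (fst (rotate_pair I a b (x, y))) = of_real a * lin x + b * lin y"
  "lin (snd (rotate_pair I a b (x, y))) = of_real a * lin y - cnj b * lin x"
  by (simp_all add: lin_def rotate_pair_def sum_distrib_left sum.distrib sum_subtractf algebra_simps)

lemma row_rotate:
  "row (fst (rotate_pair I a b (x, y))) l = of_real a * row x l + b * row y l"
  "row (snd (rotate_pair I a b (x, y))) l = of_real a * row y l - cnj b * row x l"
  by (simp_all add: row_def rotate_pair_def sum_distrib_left sum.distrib sum_subtractf algebra_simps)

text \<open>Rotating two independent copies \<open>x\<close>, \<open>x'\<close> by 45 degrees decouples \<open>x - x'\<close> from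
  \<open>x + x'\<close>.\<close>

lemma cis_diff: "cis (p - q) = cis p * cnj (cis q)"
  by (simp add: cis_cnj cis_mult)

lemma \<Phi>_square:
  "\<Phi> g1 g2 * cnj (\<Phi> g1 g2) = \<Phi> 0 (of_real (sqrt 2) * g1) * \<Phi> 0 (of_real (sqrt 2) * g2)"
proof -
  let ?V = "cgauss_vec I" and ?s = "1 / sqrt 2 :: real"
  define e where "e x = cis (Re (g2 * lin x)) * complex_of_real (exp (- nrm2 g1 x / 4))" for x
  have [measurable]: "e \<in> borel_measurable ?V"
    unfolding e_def by measurable
  have [measurable]: "cnj \<in> borel_measurable borel"
    by (intro borel_measurable_continuous_onI continuous_intros)
  have e_le: "cmod (e x) \<le> 1" for x
    by (simp add: e_def norm_mult nrm2_nonneg)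
  define f where "f x = cis (Re (of_real (sqrt 2) * g2 * lin x)) * complex_of_real (exp (- nrm2 0 x / 4))" for x
  define h where "h x = complex_of_real (exp (- nrm2 (of_real (sqrt 2) * g1) x / 4))" for x
  have fh: "f \<in> borel_measurable ?V" "h \<in> borel_measurable ?V" "cmod (f x) \<le> 1" "cmod (h x) \<le> 1" for x
    unfolding f_def h_def by (measurable, simp_all add: norm_mult nrm2_nonneg)
  have rot: "e (fst (rotate_pair I ?s ?s p)) * cnj (e (snd (rotate_pair I ?s ?s p)))
      = f (fst p) * h (snd p)" for p
  proof (cases p)
    case (Pair x y)
    let ?x = "fst (rotate_pair I ?s ?s (x, y))" and ?y = "snd (rotate_pair I ?s ?s (x, y))"
    have "1 / sqrt 2 + 1 / sqrt 2 = sqrt 2"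
      using real_div_sqrt[of 2] by linarith
    with of_real_add[of ?s ?s, where 'a=complex] have s2: "complex_of_real ?s + complex_of_real ?s = of_real (sqrt 2)"
      by (simp only:)
    have "lin ?x - lin ?y = (complex_of_real ?s + complex_of_real ?s) * lin x"
      unfolding lin_rotate complex_cnj_complex_of_real by (simp only: ring_distribs) simp
    then have diff: "lin ?x - lin ?y = of_real (sqrt 2) * lin x"
      unfolding s2 .
    have "Re (g2 * lin ?x) - Re (g2 * lin ?y) = Re (g2 * (lin ?x - lin ?y))"
      by (simp only: right_diff_distrib minus_complex.sel)
    then have lin: "Re (g2 * lin ?x) - Re (g2 * lin ?y) = Re (of_real (sqrt 2) * g2 * lin x)"
      unfolding diff by (simp only: mult_ac)
    have "(cmod (row ?x l + g1 * t l))\<^sup>2 + (cmod (row ?y l + g1 * t l))\<^sup>2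
        = (cmod (row x l))\<^sup>2 + (cmod (row y l + of_real (sqrt 2) * g1 * t l))\<^sup>2" for l
      using parallelogram[of "row x l" "row y l" "g1 * t l"]
      unfolding row_rotate complex_cnj_complex_of_real by (simp add: algebra_simps)
    then have "nrm2 g1 ?x + nrm2 g1 ?y = nrm2 0 x + nrm2 (of_real (sqrt 2) * g1) y"
      by (simp add: nrm2_def sum.distrib[symmetric])
    then have nrm: "exp (- nrm2 g1 ?x / 4) * exp (- nrm2 g1 ?y / 4)
        = exp (- nrm2 0 x / 4) * exp (- nrm2 (of_real (sqrt 2) * g1) y / 4)"
      by (simp add: exp_add[symmetric] add_divide_distrib[symmetric])
    have "e ?x * cnj (e ?y) = cis (Re (g2 * lin ?x) - Re (g2 * lin ?y)) *
        complex_of_real (exp (- nrm2 g1 ?x / 4) * exp (- nrm2 g1 ?y / 4))"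
      unfolding e_def cis_diff complex_cnj_mult complex_cnj_complex_of_real of_real_mult
      by (simp only: mult_ac)
    also have "\<dots> = f x * h y"
      unfolding lin nrm f_def h_def by simp
    finally show ?thesis
      by (simp add: Pair)
  qed
  have "\<Phi> g1 g2 * cnj (\<Phi> g1 g2) = (\<integral>x. e x \<partial>?V) * (\<integral>x. cnj (e x) \<partial>?V)"
    unfolding \<Phi>_eq e_def by (simp add: integral_cnj[symmetric] del: times_complex.sel complex_cnj_mult)
  also have "\<dots> = (\<integral>p. e (fst p) * cnj (e (snd p)) \<partial>(?V \<Otimes>\<^sub>M ?V))"
    by (rule integral_mult_pair[symmetric]) (simp_all add: e_le)
  also have "\<dots> = (\<integral>p. f (fst p) * h (snd p) \<partial>(?V \<Otimes>\<^sub>M ?V))"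
    by (subst integral_rotate_pair[OF finite_index, of ?s ?s, symmetric])
      (simp_all only: rot, simp_all add: power_divide norm_divide)
  also have "\<dots> = (\<integral>x. f x \<partial>?V) * (\<integral>x. h x \<partial>?V)"
    by (rule integral_mult_pair) (simp_all add: fh)
  also have "\<dots> = \<Phi> 0 (of_real (sqrt 2) * g2) * \<Phi> (of_real (sqrt 2) * g1) 0"
    unfolding \<Phi>_eq f_def h_def by simp
  finally show ?thesis
    by (simp add: \<Phi>_swap)
qed

lemma \<Phi>_merge:
  "\<Phi> 0 (of_real (sqrt 2) * g1) * \<Phi> 0 (of_real (sqrt 2) * g2)
   = \<Phi> 0 (of_real (sqrt 2) * merge_coeff g1 g2) * \<Phi> 0 0"
proof (cases "g1 = 0")
  case True
  then show ?thesis
    by (simp add: merge_coeff_def)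
next
  case False
  let ?V = "cgauss_vec I"
  define r where "r = sqrt ((cmod g1)\<^sup>2 + (cmod g2)\<^sup>2)"
  define g where "g = merge_coeff g1 g2"
  define a where "a = cmod g1 / r"
  define b where "b = cnj (sgn g1) * g2 / of_real r"
  have r: "r > 0" "r\<^sup>2 = (cmod g1)\<^sup>2 + (cmod g2)\<^sup>2"
    using False by (auto simp: r_def add_pos_nonneg)
  have a: "a > 0"
    using r False by (simp add: a_def)
  have ab: "a\<^sup>2 + (cmod b)\<^sup>2 = 1"
    using r False by (simp add: a_def b_def norm_mult norm_divide norm_sgn power_divide
        add_divide_distrib[symmetric])
  have g: "g = sgn g1 * of_real r"
    using False by (simp add: g_def merge_coeff_def r_def)
  have ga: "g * of_real a = g1"
    using r False by (simp add: g a_def sgn_eq)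
  have "sgn g1 * cnj (sgn g1) = 1"
    using False by (simp add: complex_norm_square[symmetric] norm_sgn)
  then have gb: "g * b = g2"
    using r by (simp add: g b_def field_simps)
  have a_b: "complex_of_real a * complex_of_real a + b * cnj b = 1"
    using ab unfolding complex_norm_square[symmetric] of_real_mult[symmetric] of_real_add[symmetric]
    by (simp add: power2_eq_square)
  define f where "f c x = cis (Re (of_real (sqrt 2) * c * lin x)) * complex_of_real (exp (- nrm2 0 x / 4))"
    for c x
  have f [measurable]: "f c \<in> borel_measurable ?V" and f_le: "cmod (f c x) \<le> 1" for c x
    unfolding f_def by (measurable, simp add: norm_mult nrm2_nonneg)
  have rot: "f g (fst (rotate_pair I a b p)) * f 0 (snd (rotate_pair I a b p))
      = f g1 (fst p) * f g2 (snd p)" for p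
  proof (cases p)
    case (Pair x y)
    let ?x = "fst (rotate_pair I a b (x, y))" and ?y = "snd (rotate_pair I a b (x, y))"
    have "of_real (sqrt 2) * g * lin ?x
        = of_real (sqrt 2) * (g * of_real a) * lin x + of_real (sqrt 2) * (g * b) * lin y"
      unfolding lin_rotate by (simp add: algebra_simps)
    then have lin: "Re (of_real (sqrt 2) * g * lin ?x)
        = Re (of_real (sqrt 2) * g1 * lin x) + Re (of_real (sqrt 2) * g2 * lin y)"
      unfolding ga gb by simp
    have "(cmod (row ?x l))\<^sup>2 + (cmod (row ?y l))\<^sup>2 = (cmod (row x l))\<^sup>2 + (cmod (row y l))\<^sup>2" for l
    proof -
      have "complex_of_real ((cmod (row ?x l))\<^sup>2 + (cmod (row ?y l))\<^sup>2)
          = (of_real a * of_real a + b * cnj b) * (row x l * cnj (row x l) + row y l * cnj (row y l))"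
        unfolding of_real_add complex_norm_square row_rotate by (simp add: algebra_simps)
      then have "complex_of_real ((cmod (row ?x l))\<^sup>2 + (cmod (row ?y l))\<^sup>2)
          = complex_of_real ((cmod (row x l))\<^sup>2 + (cmod (row y l))\<^sup>2)"
        by (simp only: a_b mult_1 of_real_add complex_norm_square)
      then show ?thesis
        unfolding of_real_eq_iff .
    qed
    then have "nrm2 0 ?x + nrm2 0 ?y = nrm2 0 x + nrm2 0 y"
      by (simp add: nrm2_def sum.distrib[symmetric])
    then have nrm: "exp (- nrm2 0 ?x / 4) * exp (- nrm2 0 ?y / 4)
        = exp (- nrm2 0 x / 4) * exp (- nrm2 0 y / 4)"
      by (simp add: exp_add[symmetric] add_divide_distrib[symmetric])
    have "f g ?x * f 0 ?y = cis (Re (of_real (sqrt 2) * g * lin ?x)) *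
        complex_of_real (exp (- nrm2 0 ?x / 4) * exp (- nrm2 0 ?y / 4))"
      by (simp add: f_def del: times_complex.sel)
    also have "\<dots> = f g1 x * f g2 y"
      unfolding lin nrm f_def cis_mult[symmetric] by simp
    finally show ?thesis
      by (simp add: Pair)
  qed
  have int: "(\<integral>p. f c (fst p) * f d (snd p) \<partial>(?V \<Otimes>\<^sub>M ?V))
      = \<Phi> 0 (of_real (sqrt 2) * c) * \<Phi> 0 (of_real (sqrt 2) * d)" for c d
  proof -
    have "(\<integral>p. f c (fst p) * f d (snd p) \<partial>(?V \<Otimes>\<^sub>M ?V)) = (\<integral>x. f c x \<partial>?V) * (\<integral>x. f d x \<partial>?V)"
      by (rule integral_mult_pair) (rule f f_le)+
    moreover have "(\<integral>x. f e x \<partial>?V) = \<Phi> 0 (of_real (sqrt 2) * e)" for e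
      unfolding \<Phi>_eq f_def ..
    ultimately show ?thesis
      by (simp only:)
  qed
  have "\<Phi> 0 (of_real (sqrt 2) * g) * \<Phi> 0 (of_real (sqrt 2) * 0)
      = (\<integral>p. f g1 (fst p) * f g2 (snd p) \<partial>(?V \<Otimes>\<^sub>M ?V))"
    unfolding int[symmetric]
    by (subst integral_rotate_pair[OF finite_index a ab, symmetric]) (simp_all only: rot, simp_all)
  then show ?thesis
    unfolding int g_def by simp
qed

theorem \<Phi>_merge_coeff: "of_real (cmod (\<Phi> g1 g2)) = \<Phi> 0 (merge_coeff g1 g2)"
proof -
  let ?g = "merge_coeff g1 g2"
  have "complex_of_real ((cmod (\<Phi> g1 g2))\<^sup>2) = \<Phi> 0 (of_real (sqrt 2) * ?g) * \<Phi> 0 0"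
    unfolding complex_norm_square \<Phi>_square \<Phi>_merge ..
  also have "\<dots> = complex_of_real ((cmod (\<Phi> 0 ?g))\<^sup>2)"
    unfolding complex_norm_square \<Phi>_square by simp
  finally have "cmod (\<Phi> g1 g2) = cmod (\<Phi> 0 ?g)"
    by (simp add: power2_eq_iff_nonneg flip: of_real_power)
  then show ?thesis
    using \<Phi>_pos_real by simp
qed

end

section \<open>Hafnians of edge weights\<close>

definition edges :: "nat set \<Rightarrow> nat set set" where
  "edges V = {e. e \<subseteq> V \<and> card e = 2}"

definition hafnian :: "nat set \<Rightarrow> (nat set \<Rightarrow> complex) \<Rightarrow> complex" where
  "hafnian V b = (\<Sum>M\<in>perfect_matchings V. \<Prod>e\<in>M. b e)"

lemma finite_edges: "finite V \<Longrightarrow> finite (edges V)"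
  by (rule finite_subset[of _ "Pow V"]) (auto simp: edges_def)

lemma edges_mono: "V \<subseteq> W \<Longrightarrow> edges V \<subseteq> edges W"
  by (auto simp: edges_def)

lemma perfect_matchings_edges: "M \<in> perfect_matchings V \<Longrightarrow> M \<subseteq> edges V"
  by (auto simp: perfect_matchings_def edges_def partition_on_def)

lemma hafnian_cong:
  assumes "\<And>e. e \<in> edges V \<Longrightarrow> b e = b' e"
  shows "hafnian V b = hafnian V b'"
  unfolding hafnian_def
  using perfect_matchings_edges assms by (intro sum.cong prod.cong refl) blast

lemma measurable_hafnian [measurable (raw)]:
  assumes "edges V \<subseteq> J" and "f \<in> N \<rightarrow>\<^sub>M cgauss_vec J"
  shows "(\<lambda>x. hafnian V (f x)) \<in> borel_measurable N"
proof -
  have "hafnian V \<in> borel_measurable (cgauss_vec J)"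
    unfolding hafnian_def
  proof (intro borel_measurable_sum borel_measurable_prod)
    fix M e assume "M \<in> perfect_matchings V" "e \<in> M"
    then have "e \<in> J"
      using perfect_matchings_edges assms(1) by blast
    then show "(\<lambda>b. b e) \<in> borel_measurable (cgauss_vec J)"
      by measurable
  qed
  then show ?thesis
    by (rule measurable_compose[OF assms(2)])
qed

lemma edge_endpoint:
  assumes "e \<in> edges (insert u V)" "u \<in> e" "u \<notin> V"
  obtains k where "k \<in> V" "e = {u, k}"
proof -
  from assms(1) have "card e = 2" and sub: "e \<subseteq> insert u V"
    by (simp_all add: edges_def)
  then obtain p q where "e = {p, q}" "p \<noteq> q"
    by (meson card_2_iff)
  then obtain k where k: "e = {u, k}" "k \<noteq> u"
    using assms(2) by blast
  then have "k \<in> V"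
    using sub by blast
  then show thesis
    using k that by blast
qed

lemma edges_insert:
  assumes "u \<notin> V"
  shows "edges (insert u V) = edges V \<union> (\<lambda>k. {u, k}) ` V"
proof (intro equalityI subsetI)
  fix e assume e: "e \<in> edges (insert u V)"
  show "e \<in> edges V \<union> (\<lambda>k. {u, k}) ` V"
  proof (cases "u \<in> e")
    case True
    then show ?thesis
      by (rule edge_endpoint[OF e _ assms]) simp
  next
    case False
    then show ?thesis
      using e by (auto simp: edges_def)
  qed
next
  fix e assume "e \<in> edges V \<union> (\<lambda>k. {u, k}) ` V"
  then show "e \<in> edges (insert u V)"
    using assms by (auto simp: edges_def card_insert_if)
qed

lemma perfect_matchings_insert:
  assumes "u \<notin> V"
  shows "perfect_matchings (insert u V) = (\<Union>k\<in>V. insert {u, k} ` perfect_matchings (V - {k}))"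
proof (intro equalityI subsetI)
  fix M assume M: "M \<in> perfect_matchings (insert u V)"
  then have U: "\<Union>M = insert u V" and disj: "disjoint M" and ne: "{} \<notin> M"
    and c2: "\<forall>e\<in>M. card e = 2"
    by (simp_all add: perfect_matchings_def partition_on_def)
  have "u \<in> \<Union>M"
    unfolding U by simp
  then obtain e where e: "e \<in> M" "u \<in> e"
    by blast
  from e(1) perfect_matchings_edges[OF M] have "e \<in> edges (insert u V)"
    by (rule rev_subsetD)
  then obtain k where k: "k \<in> V" "e = {u, k}"
    by (rule edge_endpoint[OF _ e(2) assms])
  have "e \<inter> e' = {}" if "e' \<in> M - {e}" for e'
    using disjointD[OF disj e(1), of e'] that by auto
  then have "\<Union>(M - {e}) = \<Union>M - e"
    using e(1) by blast
  also have "\<dots> = V - {k}"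
    unfolding U k(2) using assms by blast
  finally have "M - {e} \<in> perfect_matchings (V - {k})"
    using ne c2 disj by (simp add: perfect_matchings_def partition_on_def disjoint_def)
  moreover have "M = insert {u, k} (M - {e})"
    using e(1) unfolding k(2) by blast
  ultimately show "M \<in> (\<Union>k\<in>V. insert {u, k} ` perfect_matchings (V - {k}))"
    using k(1) by blast
next
  fix M assume "M \<in> (\<Union>k\<in>V. insert {u, k} ` perfect_matchings (V - {k}))"
  then obtain k N where k: "k \<in> V" and M: "M = insert {u, k} N"
    and N: "N \<in> perfect_matchings (V - {k})"
    by blast
  have "u \<noteq> k"
    using assms k by blast
  have U: "\<Union>N = V - {k}" and disj: "disjoint N" and ne: "{} \<notin> N" and c2: "\<forall>e\<in>N. card e = 2"
    using N by (simp_all add: perfect_matchings_def partition_on_def)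
  have "{u, k} \<inter> e = {}" if "e \<in> N" for e
  proof -
    have "e \<subseteq> V - {k}"
      unfolding U[symmetric] using that by (rule Union_upper)
    then show ?thesis
      using assms by blast
  qed
  then have "disjoint M"
    unfolding M using disj by (auto simp: disjoint_def)
  moreover have "\<Union>M = insert u V"
    unfolding M Union_insert U using k by blast
  ultimately show "M \<in> perfect_matchings (insert u V)"
    using ne c2 \<open>u \<noteq> k\<close> unfolding perfect_matchings_def partition_on_def M by simp
qed

lemma finite_perfect_matchings:
  assumes "finite V"
  shows "finite (perfect_matchings V)"
proof (rule finite_subset)
  show "perfect_matchings V \<subseteq> Pow (edges V)"
    by (rule subsetI) (simp add: perfect_matchings_edges)
  show "finite (Pow (edges V))"
    using assms by (simp add: finite_edges)
qed

lemma hafnian_insert: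
  assumes "finite V" "u \<notin> V"
  shows "hafnian (insert u V) b = (\<Sum>k\<in>V. b {u, k} * hafnian (V - {k}) b)"
proof -
  have no_u: "{u, k} \<notin> M" if "M \<in> perfect_matchings (V - {l})" for k l M
    using perfect_matchings_edges[OF that] assms(2) by (auto simp: edges_def)
  have "hafnian (insert u V) b
      = (\<Sum>k\<in>V. \<Sum>M\<in>insert {u, k} ` perfect_matchings (V - {k}). \<Prod>e\<in>M. b e)"
    unfolding hafnian_def perfect_matchings_insert[OF assms(2)]
  proof (rule sum.UNION_disjoint[OF assms(1)])
    show "\<forall>k\<in>V. finite (insert {u, k} ` perfect_matchings (V - {k}))"
      using assms(1) by (simp add: finite_perfect_matchings)
    show "\<forall>k\<in>V. \<forall>l\<in>V. k \<noteq> l \<longrightarrow> insert {u, k} ` perfect_matchings (V - {k}) \<inter>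
        insert {u, l} ` perfect_matchings (V - {l}) = {}"
    proof (intro ballI impI equals0I)
      fix k l M assume "k \<in> V" "l \<in> V" "k \<noteq> l"
        and "M \<in> insert {u, k} ` perfect_matchings (V - {k}) \<inter>
          insert {u, l} ` perfect_matchings (V - {l})"
      then obtain N N' where "N' \<in> perfect_matchings (V - {l})"
        "insert {u, k} N = insert {u, l} N'"
        by auto
      then have "{u, k} \<in> insert {u, l} N'" "{u, k} \<notin> N'"
        using no_u[of N' l k] by auto
      then have "{u, k} = {u, l}"
        by simp
      with \<open>k \<noteq> l\<close> show False
        by (auto simp: doubleton_eq_iff)
    qed
  qed
  also have "\<dots> = (\<Sum>k\<in>V. b {u, k} * hafnian (V - {k}) b)"
  proof (rule sum.cong[OF refl])
    fix k
    have "inj_on (insert {u, k}) (perfect_matchings (V - {k}))"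
      by (rule inj_onI) (simp add: insert_ident no_u)
    moreover have "finite M" if "M \<in> perfect_matchings (V - {k})" for M
      using finite_subset[OF perfect_matchings_edges[OF that]] assms(1) by (simp add: finite_edges)
    ultimately show "(\<Sum>M\<in>insert {u, k} ` perfect_matchings (V - {k}). \<Prod>e\<in>M. b e)
        = b {u, k} * hafnian (V - {k}) b"
      using no_u by (simp add: sum.reindex hafnian_def sum_distrib_left)
  qed
  finally show ?thesis .
qed

definition add_vertex ::
    "nat \<Rightarrow> nat set \<Rightarrow> (nat set \<Rightarrow> complex) \<times> (nat \<Rightarrow> complex) \<Rightarrow> nat set \<Rightarrow> complex" where
  "add_vertex u V = (\<lambda>(b, y). \<lambda>e\<in>edges (insert u V). if u \<in> e then y (the_elem (e - {u})) else b e)"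

lemma add_vertex_new: "u \<notin> V \<Longrightarrow> k \<in> V \<Longrightarrow> add_vertex u V (b, y) {u, k} = y k"
  by (auto simp: add_vertex_def edges_insert insert_Diff_if)

lemma add_vertex_old: "u \<notin> V \<Longrightarrow> e \<in> edges V \<Longrightarrow> add_vertex u V (b, y) e = b e"
  by (auto simp: add_vertex_def edges_def)

lemma hafnian_add_vertex_old:
  "u \<notin> V \<Longrightarrow> W \<subseteq> V \<Longrightarrow> hafnian W (add_vertex u V (b, y)) = hafnian W b"
  by (rule hafnian_cong) (meson add_vertex_old edges_mono subsetD)

lemma hafnian_add_vertex_new:
  assumes "finite V" "u \<notin> V" "W \<subseteq> V"
  shows "hafnian (insert u W) (add_vertex u V (b, y)) = (\<Sum>k\<in>W. y k * hafnian (W - {k}) b)"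
  using assms
  by (subst hafnian_insert)
    (auto intro!: sum.cong arg_cong2[where f="(*)"] add_vertex_new hafnian_add_vertex_old
      intro: finite_subset)

lemma measurable_add_vertex [measurable]:
  assumes "u \<notin> V"
  shows "add_vertex u V \<in> cgauss_vec (edges V) \<Otimes>\<^sub>M cgauss_vec V \<rightarrow>\<^sub>M cgauss_vec (edges (insert u V))"
  unfolding add_vertex_def split_beta'
proof (rule measurable_restrict)
  fix e assume e: "e \<in> edges (insert u V)"
  show "(\<lambda>p. if u \<in> e then snd p (the_elem (e - {u})) else fst p e)
      \<in> cgauss_vec (edges V) \<Otimes>\<^sub>M cgauss_vec V \<rightarrow>\<^sub>M cgauss"
  proof (cases "u \<in> e")
    case True
    then obtain k where "k \<in> V" "e = {u, k}"
      by (rule edge_endpoint[OF e _ assms])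
    moreover from this have "e - {u} = {k}"
      using assms by auto
    ultimately show ?thesis
      using True by simp
  next
    case False
    then have "e \<in> edges V"
      using e by (auto simp: edges_def)
    then show ?thesis
      using False by simp
  qed
qed

lemma distr_add_vertex:
  assumes "finite V" "u \<notin> V"
  shows "distr (cgauss_vec (edges V) \<Otimes>\<^sub>M cgauss_vec V) (cgauss_vec (edges (insert u V)))
    (add_vertex u V) = cgauss_vec (edges (insert u V))"
proof (rule cgauss_prod.PiM_eqI)
  show "finite (edges (insert u V))"
    using assms by (simp add: finite_edges)
  fix A :: "nat set \<Rightarrow> complex set"
  assume A: "\<And>e. e \<in> edges (insert u V) \<Longrightarrow> A e \<in> sets cgauss"
  interpret V: prob_space "cgauss_vec V"
    by (rule prob_space_cgauss_vec)
  have inj: "inj_on (\<lambda>k. {u, k}) V"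
    by (auto intro!: inj_onI simp: doubleton_eq_iff)
  have disj: "edges V \<inter> (\<lambda>k. {u, k}) ` V = {}"
    using assms by (auto simp: edges_def)
  have pre: "add_vertex u V -` Pi\<^sub>E (edges (insert u V)) A
      \<inter> space (cgauss_vec (edges V) \<Otimes>\<^sub>M cgauss_vec V)
      = Pi\<^sub>E (edges V) A \<times> Pi\<^sub>E V (\<lambda>k. A {u, k})"
  proof -
    have iff: "add_vertex u V (b, y) \<in> Pi\<^sub>E (edges (insert u V)) A \<longleftrightarrow>
        (\<forall>e\<in>edges V. b e \<in> A e) \<and> (\<forall>k\<in>V. y k \<in> A {u, k})" for b y
    proof -
      have "add_vertex u V (b, y) \<in> extensional (edges (insert u V))"
        by (simp add: add_vertex_def)
      then have "add_vertex u V (b, y) \<in> Pi\<^sub>E (edges (insert u V)) A \<longleftrightarrow>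
          (\<forall>e\<in>edges V \<union> (\<lambda>k. {u, k}) ` V. add_vertex u V (b, y) e \<in> A e)"
        by (simp add: PiE_def Pi_def Ball_def edges_insert[OF assms(2), symmetric])
      then show ?thesis
        by (simp add: ball_Un add_vertex_old add_vertex_new assms)
    qed
    show ?thesis
    proof (rule set_eqI, clarify)
      fix b y
      show "(b, y) \<in> add_vertex u V -` Pi\<^sub>E (edges (insert u V)) A
          \<inter> space (cgauss_vec (edges V) \<Otimes>\<^sub>M cgauss_vec V)
          \<longleftrightarrow> (b, y) \<in> Pi\<^sub>E (edges V) A \<times> Pi\<^sub>E V (\<lambda>k. A {u, k})"
        unfolding Int_iff vimage_eq iff by (auto simp: space_pair_measure space_PiM PiE_def Pi_def)
    qed
  qed
  have "emeasure (distr (cgauss_vec (edges V) \<Otimes>\<^sub>M cgauss_vec V) (cgauss_vec (edges (insert u V)))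
      (add_vertex u V)) (Pi\<^sub>E (edges (insert u V)) A)
      = emeasure (cgauss_vec (edges V) \<Otimes>\<^sub>M cgauss_vec V)
          (Pi\<^sub>E (edges V) A \<times> Pi\<^sub>E V (\<lambda>k. A {u, k}))"
    using A assms by (subst emeasure_distr) (auto simp: pre finite_edges intro!: sets_PiM_I_finite)
  also have "\<dots> = (\<Prod>e\<in>edges V. emeasure cgauss (A e)) * (\<Prod>k\<in>V. emeasure cgauss (A {u, k}))"
    using A assms
    by (subst V.emeasure_pair_measure_Times)
      (auto simp: finite_edges edges_insert cgauss_prod.emeasure_PiM intro!: sets_PiM_I_finite)
  also have "\<dots> = (\<Prod>e\<in>edges (insert u V). emeasure cgauss (A e))"
    using assms disj inj
    by (simp add: edges_insert finite_edges prod.union_disjoint prod.reindex)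
  finally show "emeasure (distr (cgauss_vec (edges V) \<Otimes>\<^sub>M cgauss_vec V)
      (cgauss_vec (edges (insert u V))) (add_vertex u V)) (Pi\<^sub>E (edges (insert u V)) A)
      = (\<Prod>e\<in>edges (insert u V). emeasure cgauss (A e))" .
qed simp

lemma integral_add_vertex:
  fixes f :: "(nat set \<Rightarrow> complex) \<Rightarrow> complex"
  assumes V: "finite V" "u \<notin> V" and int: "integrable (cgauss_vec (edges (insert u V))) f"
  shows "(\<integral>b. f b \<partial>cgauss_vec (edges (insert u V)))
       = (\<integral>b. (\<integral>y. f (add_vertex u V (b, y)) \<partial>cgauss_vec V) \<partial>cgauss_vec (edges V))"
    and "integrable (cgauss_vec (edges V)) (\<lambda>b. \<integral>y. f (add_vertex u V (b, y)) \<partial>cgauss_vec V)"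
proof -
  interpret P: pair_prob_space "cgauss_vec (edges V)" "cgauss_vec V"
    by (rule pair_prob_space_cgauss_vec)
  note meas = measurable_add_vertex[OF V(2)]
  have int': "integrable (cgauss_vec (edges V) \<Otimes>\<^sub>M cgauss_vec V) (\<lambda>p. f (add_vertex u V p))"
    using int by (intro integrable_distr[OF meas]) (simp add: distr_add_vertex[OF V])
  then show "integrable (cgauss_vec (edges V)) (\<lambda>b. \<integral>y. f (add_vertex u V (b, y)) \<partial>cgauss_vec V)"
    by (rule P.integrable_fst')
  from int' have "(\<integral>p. f (add_vertex u V p) \<partial>(cgauss_vec (edges V) \<Otimes>\<^sub>M cgauss_vec V))
      = (\<integral>b. (\<integral>y. f (add_vertex u V (b, y)) \<partial>cgauss_vec V) \<partial>cgauss_vec (edges V))"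
    by (rule P.integral_fst'[symmetric])
  moreover have "(\<integral>b. f b \<partial>cgauss_vec (edges (insert u V)))
      = (\<integral>p. f (add_vertex u V p) \<partial>(cgauss_vec (edges V) \<Otimes>\<^sub>M cgauss_vec V))"
    using integral_distr[OF meas, of f] int by (simp add: distr_add_vertex[OF V])
  ultimately show "(\<integral>b. f b \<partial>cgauss_vec (edges (insert u V)))
      = (\<integral>b. (\<integral>y. f (add_vertex u V (b, y)) \<partial>cgauss_vec V) \<partial>cgauss_vec (edges V))"
    by simp
qed

lemma nn_integral_add_vertex:
  assumes V: "finite V" "u \<notin> V" and [measurable]: "f \<in> borel_measurable (cgauss_vec (edges (insert u V)))"
  shows "(\<integral>\<^sup>+b. f b \<partial>cgauss_vec (edges (insert u V)))
       = (\<integral>\<^sup>+b. (\<integral>\<^sup>+y. f (add_vertex u V (b, y)) \<partial>cgauss_vec V) \<partial>cgauss_vec (edges V))"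
proof -
  interpret V: prob_space "cgauss_vec V"
    by (rule prob_space_cgauss_vec)
  note [measurable] = measurable_add_vertex[OF V(2)]
  have "(\<integral>\<^sup>+b. f b \<partial>cgauss_vec (edges (insert u V)))
      = (\<integral>\<^sup>+p. f (add_vertex u V p) \<partial>(cgauss_vec (edges V) \<Otimes>\<^sub>M cgauss_vec V))"
    using nn_integral_distr[OF measurable_add_vertex[OF V(2)], of f]
    by (simp add: distr_add_vertex[OF V])
  then show ?thesis
    by (simp add: V.nn_integral_fst[symmetric])
qed

section \<open>Characteristic functions of hafnian cofactor vectors\<close>

definition cofactor_form :: "nat set \<Rightarrow> (nat \<Rightarrow> complex) \<Rightarrow> (nat set \<Rightarrow> complex) \<Rightarrow> complex" where
  "cofactor_form V g b = (\<Sum>j\<in>V. g j * hafnian (V - {j}) b)"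

definition cofactor_char :: "nat set \<Rightarrow> (nat \<Rightarrow> complex) \<Rightarrow> complex" where
  "cofactor_char V g = (\<integral>b. cis (Re (cofactor_form V g b)) \<partial>cgauss_vec (edges V))"

definition cofactor_norm2 :: "nat set \<Rightarrow> (nat set \<Rightarrow> complex) \<Rightarrow> real" where
  "cofactor_norm2 V b = (\<Sum>j\<in>V. (cmod (hafnian (V - {j}) b))\<^sup>2)"

definition two_row_form ::
    "nat set \<Rightarrow> (nat \<Rightarrow> complex) \<Rightarrow> (nat set \<Rightarrow> complex) \<Rightarrow> nat \<Rightarrow> nat \<Rightarrow> complex" where
  "two_row_form W g b k l =
     (if k = l then 0 else \<Sum>j\<in>W - {k, l}. g j * hafnian (W - {j, k, l}) b)"

lemma cofactor_norm2_nonneg: "cofactor_norm2 V b \<ge> 0"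
  by (simp add: cofactor_norm2_def sum_nonneg)

lemma measurable_cofactor [measurable]:
  "(\<lambda>b. hafnian (V - {j}) b) \<in> borel_measurable (cgauss_vec (edges V))"
  by (rule measurable_hafnian[OF edges_mono measurable_ident_sets]) auto

lemma measurable_cofactor_form [measurable]:
  "cofactor_form V g \<in> borel_measurable (cgauss_vec (edges V))"
  unfolding cofactor_form_def by measurable

lemma measurable_cofactor_norm2 [measurable]:
  "cofactor_norm2 V \<in> borel_measurable (cgauss_vec (edges V))"
  unfolding cofactor_norm2_def by measurable

lemma sum_two_row_form:
  fixes x y :: "nat \<Rightarrow> complex"
  assumes "finite W"
  shows "(\<Sum>j\<in>W. g j * (\<Sum>l\<in>W - {j}. y l * (\<Sum>k\<in>W - {j} - {l}. x k * hafnian (W - {j} - {l} - {k}) b)))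
    = (\<Sum>k\<in>W. \<Sum>l\<in>W. x k * two_row_form W g b k l * y l)"
proof -
  define H where "H j l k = (if j \<noteq> l \<and> j \<noteq> k \<and> l \<noteq> k
    then g j * y l * x k * hafnian (W - {j, k, l}) b else 0)" for j l k
  have sets: "W - {j} - {l} - {k} = W - {j, k, l}" for j l k
    by auto
  have "(\<Sum>j\<in>W. g j * (\<Sum>l\<in>W - {j}. y l * (\<Sum>k\<in>W - {j} - {l}. x k * hafnian (W - {j} - {l} - {k}) b)))
      = (\<Sum>j\<in>W. \<Sum>l\<in>W. \<Sum>k\<in>W. H j l k)"
  proof (rule sum.cong[OF refl])
    fix j assume "j \<in> W"
    have "(\<Sum>l\<in>W. \<Sum>k\<in>W. H j l k) = (\<Sum>l\<in>W - {j}. \<Sum>k\<in>W. H j l k)"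
      using assms by (intro sum.mono_neutral_right) (auto simp: H_def)
    also have "\<dots> = (\<Sum>l\<in>W - {j}. \<Sum>k\<in>W - {j} - {l}. H j l k)"
      using assms by (intro sum.cong refl sum.mono_neutral_right) (auto simp: H_def)
    also have "\<dots> = g j * (\<Sum>l\<in>W - {j}. y l * (\<Sum>k\<in>W - {j} - {l}. x k * hafnian (W - {j} - {l} - {k}) b))"
      unfolding sum_distrib_left sets by (intro sum.cong refl) (auto simp: H_def)
    finally show "g j * (\<Sum>l\<in>W - {j}. y l * (\<Sum>k\<in>W - {j} - {l}. x k * hafnian (W - {j} - {l} - {k}) b))
      = (\<Sum>l\<in>W. \<Sum>k\<in>W. H j l k)" ..
  qed
  also have "\<dots> = (\<Sum>l\<in>W. \<Sum>k\<in>W. \<Sum>j\<in>W. H j l k)"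
    by (subst sum.swap, rule sum.cong[OF refl], rule sum.swap)
  also have "\<dots> = (\<Sum>k\<in>W. \<Sum>l\<in>W. \<Sum>j\<in>W. H j l k)"
    by (rule sum.swap)
  also have "\<dots> = (\<Sum>k\<in>W. \<Sum>l\<in>W. x k * two_row_form W g b k l * y l)"
  proof (intro sum.cong refl)
    fix k l
    show "(\<Sum>j\<in>W. H j l k) = x k * two_row_form W g b k l * y l"
    proof (cases "k = l")
      case True
      then show ?thesis
        by (simp add: H_def two_row_form_def)
    next
      case False
      have "(\<Sum>j\<in>W. H j l k) = (\<Sum>j\<in>W - {k, l}. H j l k)"
        using assms by (intro sum.mono_neutral_right) (auto simp: H_def)
      also have "\<dots> = x k * two_row_form W g b k l * y l"
        using False unfolding two_row_form_def if_not_P[OF False] sum_distrib_left sum_distrib_right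
        by (intro sum.cong refl) (auto simp: H_def)
      finally show ?thesis .
    qed
  qed
  finally show ?thesis .
qed

lemma symmetric_two_row_form:
  "finite W \<Longrightarrow> symmetric_form W (two_row_form W g b)"
  by unfold_locales (auto simp: two_row_form_def insert_commute)

lemma cofactor_form_two_rows:
  fixes g x y D
  assumes W: "finite W" and uv: "u \<noteq> v" "u \<notin> W" "v \<notin> W"
  defines "t \<equiv> \<lambda>k. hafnian (W - {k}) D" and "S \<equiv> two_row_form W g D"
  shows "cofactor_form (insert v (insert u W)) g
      (add_vertex v (insert u W) (add_vertex u W (D, x), y))
    = (\<Sum>j\<in>W. g j * t j) * y u + (symmetric_form.form W S x y + g u * symmetric_form.lin W t y
        + g v * symmetric_form.lin W t x)"
proof -
  interpret symmetric_form W S t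
    unfolding S_def using W by (rule symmetric_two_row_form)
  let ?D' = "add_vertex u W (D, x)"
  let ?b = "add_vertex v (insert u W) (?D', y)"
  have v: "v \<notin> insert u W"
    using uv by auto
  have hu: "hafnian (insert u W') ?D' = (\<Sum>k\<in>W'. x k * hafnian (W' - {k}) D)" if "W' \<subseteq> W" for W'
    using hafnian_add_vertex_new[OF W uv(2) that] .
  have hv: "hafnian (insert v W') ?b = (\<Sum>l\<in>W'. y l * hafnian (W' - {l}) ?D')"
    if "W' \<subseteq> insert u W" for W'
    using hafnian_add_vertex_new[OF _ v that] W by simp
  have old: "hafnian W' ?D' = hafnian W' D" if "W' \<subseteq> W" for W'
    using hafnian_add_vertex_old[OF uv(2) that] .
  have 1: "hafnian (insert u W) ?b = lin x"
    using hafnian_add_vertex_old[OF v order.refl] hu[of W]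
    unfolding lin_def by (simp add: t_def mult.commute)
  have 2: "hafnian (insert v W) ?b = lin y"
    using hv[of W] unfolding lin_def by (simp add: subset_insertI t_def mult.commute old)
  have 3: "hafnian (insert v (insert u (W - {j}))) ?b = y u * t j +
      (\<Sum>l\<in>W - {j}. y l * (\<Sum>k\<in>W - {j} - {l}. x k * hafnian (W - {j} - {l} - {k}) D))"
    if "j \<in> W" for j
  proof -
    have "hafnian (insert v (insert u (W - {j}))) ?b
        = (\<Sum>l\<in>insert u (W - {j}). y l * hafnian (insert u (W - {j}) - {l}) ?D')"
      by (rule hv) auto
    also have "\<dots> = y u * hafnian (insert u (W - {j}) - {u}) ?D' +
        (\<Sum>l\<in>W - {j}. y l * hafnian (insert u (W - {j}) - {l}) ?D')"
      using W uv by simp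
    also have "insert u (W - {j}) - {u} = W - {j}"
      using uv by auto
    also have "hafnian (W - {j}) ?D' = t j"
      unfolding t_def by (rule old) auto
    also have "(\<Sum>l\<in>W - {j}. y l * hafnian (insert u (W - {j}) - {l}) ?D')
        = (\<Sum>l\<in>W - {j}. y l * (\<Sum>k\<in>W - {j} - {l}. x k * hafnian (W - {j} - {l} - {k}) D))"
    proof (rule sum.cong[OF refl])
      fix l assume "l \<in> W - {j}"
      then have "insert u (W - {j}) - {l} = insert u (W - {j} - {l})"
        using uv by auto
      then show "y l * hafnian (insert u (W - {j}) - {l}) ?D'
          = y l * (\<Sum>k\<in>W - {j} - {l}. x k * hafnian (W - {j} - {l} - {k}) D)"
        by (simp add: hu Diff_subset subset_trans[OF Diff_subset Diff_subset])
    qed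
    finally show ?thesis .
  qed
  have sets: "insert v (insert u W) - {v} = insert u W" "insert v (insert u W) - {u} = insert v W"
    using uv by auto
  have sets': "insert v (insert u W) - {j} = insert v (insert u (W - {j}))" if "j \<in> W" for j
    using uv that by auto
  have "cofactor_form (insert v (insert u W)) g ?b
      = g v * lin x + (g u * lin y + (\<Sum>j\<in>W. g j * hafnian (insert v (insert u W) - {j}) ?b))"
    using W uv by (simp add: cofactor_form_def sets 1 2)
  also have "(\<Sum>j\<in>W. g j * hafnian (insert v (insert u W) - {j}) ?b)
      = (\<Sum>j\<in>W. g j * t j) * y u + form x y"
  proof -
    have "(\<Sum>j\<in>W. g j * hafnian (insert v (insert u W) - {j}) ?b) = (\<Sum>j\<in>W. g j * t j * y u +
        g j * (\<Sum>l\<in>W - {j}. y l * (\<Sum>k\<in>W - {j} - {l}. x k * hafnian (W - {j} - {l} - {k}) D)))"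
    proof (rule sum.cong[OF refl])
      fix j assume j: "j \<in> W"
      show "g j * hafnian (insert v (insert u W) - {j}) ?b = g j * t j * y u +
        g j * (\<Sum>l\<in>W - {j}. y l * (\<Sum>k\<in>W - {j} - {l}. x k * hafnian (W - {j} - {l} - {k}) D))"
        unfolding sets'[OF j] 3[OF j] distrib_left by simp
    qed
    also have "\<dots> = (\<Sum>j\<in>W. g j * t j) * y u + (\<Sum>k\<in>W. \<Sum>l\<in>W. x k * two_row_form W g D k l * y l)"
      unfolding sum.distrib sum_two_row_form[OF W] sum_distrib_right ..
    finally show ?thesis
      unfolding form_def unfolding S_def .
  qed
  finally show ?thesis
    by (simp add: algebra_simps)
qed

lemma cofactor_char_two_rows:
  assumes W: "finite W" and uv: "u \<noteq> v" "u \<notin> W" "v \<notin> W"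
  shows "cofactor_char (insert v (insert u W)) g =
    (\<integral>D. of_real (exp (- (cmod (\<Sum>j\<in>W. g j * hafnian (W - {j}) D))\<^sup>2 / 4)) *
      symmetric_form.\<Phi> W (two_row_form W g D) (\<lambda>k. hafnian (W - {k}) D) (g u) (g v)
      \<partial>cgauss_vec (edges W))"
proof -
  let ?V = "insert v (insert u W)"
  interpret E: prob_space "cgauss_vec (edges ?V)"
    by (rule prob_space_cgauss_vec)
  interpret uW: prob_space "cgauss_vec (insert u W)"
    by (rule prob_space_cgauss_vec)
  have fin: "finite (insert u W)" and v: "v \<notin> insert u W"
    using W uv by auto
  let ?f = "\<lambda>b. cis (Re (cofactor_form ?V g b))"
  have int: "integrable (cgauss_vec (edges ?V)) ?f"
    by (rule E.integrable_const_bound[where B=1]) simp_all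
  have "cofactor_char ?V g = (\<integral>D. (\<integral>x. (\<integral>y. ?f (add_vertex v (insert u W) (add_vertex u W (D, x), y))
      \<partial>cgauss_vec (insert u W)) \<partial>cgauss_vec W) \<partial>cgauss_vec (edges W))"
    unfolding cofactor_char_def integral_add_vertex(1)[OF fin v int]
    by (rule integral_add_vertex(1)[OF W uv(2) integral_add_vertex(2)[OF fin v int]])
  also have "\<dots> = (\<integral>D. of_real (exp (- (cmod (\<Sum>j\<in>W. g j * hafnian (W - {j}) D))\<^sup>2 / 4)) *
      symmetric_form.\<Phi> W (two_row_form W g D) (\<lambda>k. hafnian (W - {k}) D) (g u) (g v)
      \<partial>cgauss_vec (edges W))"
  proof (rule Bochner_Integration.integral_cong[OF refl])
    fix D
    interpret symmetric_form W "two_row_form W g D" "\<lambda>k. hafnian (W - {k}) D"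
      using W by (rule symmetric_two_row_form)
    define \<tau> where "\<tau> = (\<Sum>j\<in>W. g j * hafnian (W - {j}) D)"
    have inner: "(\<integral>y. ?f (add_vertex v (insert u W) (add_vertex u W (D, x), y))
        \<partial>cgauss_vec (insert u W)) = of_real (exp (- (cmod \<tau>)\<^sup>2 / 4)) *
          (\<integral>y. cis (Re (form x y + g u * lin y + g v * lin x)) \<partial>cgauss_vec W)" for x
    proof -
      have upd: "form x (y(u := z)) = form x y" "lin (y(u := z)) = lin y" for y z
        using uv by (auto simp: form_def lin_def intro!: sum.cong)
      let ?h = "\<lambda>y. cis (Re (\<tau> * y u + (form x y + g u * lin y + g v * lin x)))"
      have "?h \<in> borel_measurable (cgauss_vec (insert u W))"
        unfolding form_def lin_def by measurable
      then have "integrable (cgauss_vec (insert u W)) ?h"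
        by (intro uW.integrable_const_bound[where B=1]) simp
      then have "(\<integral>y. ?h y \<partial>cgauss_vec (insert u W))
          = (\<integral>y. (\<integral>z. ?h (y(u := z)) \<partial>cgauss) \<partial>cgauss_vec W)"
        by (rule cgauss_prod.product_integral_insert[OF W uv(2)])
      also have "\<dots> = (\<integral>y. (\<integral>z. cis (Re (\<tau> * z)) * cis (Re (form x y + g u * lin y + g v * lin x)) \<partial>cgauss)
          \<partial>cgauss_vec W)"
        unfolding cis_mult upd fun_upd_same plus_complex.sel ..
      also have "\<dots> = of_real (exp (- (cmod \<tau>)\<^sup>2 / 4)) *
          (\<integral>y. cis (Re (form x y + g u * lin y + g v * lin x)) \<partial>cgauss_vec W)"
        unfolding integral_mult_left_zero cgauss_char integral_mult_right_zero ..
      finally show ?thesis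
        unfolding cofactor_form_two_rows[OF W uv] \<tau>_def[symmetric] .
    qed
    show "(\<integral>x. (\<integral>y. ?f (add_vertex v (insert u W) (add_vertex u W (D, x), y))
        \<partial>cgauss_vec (insert u W)) \<partial>cgauss_vec W)
      = of_real (exp (- (cmod (\<Sum>j\<in>W. g j * hafnian (W - {j}) D))\<^sup>2 / 4)) * \<Phi> (g u) (g v)"
      unfolding inner \<Phi>_def \<tau>_def[symmetric] by (rule integral_mult_right_zero)
  qed
  finally show ?thesis .
qed

lemma cofactor_char_merge:
  assumes W: "finite W" and uv: "u \<noteq> v" "u \<notin> W" "v \<notin> W"
  shows "cmod (cofactor_char (insert v (insert u W)) g)
    \<le> cmod (cofactor_char (insert v (insert u W)) (g(u := 0, v := merge_coeff (g u) (g v))))"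
proof -
  let ?V = "insert v (insert u W)" and ?g = "g(u := 0, v := merge_coeff (g u) (g v))"
  let ?F = "\<lambda>g D. of_real (exp (- (cmod (\<Sum>j\<in>W. g j * hafnian (W - {j}) D))\<^sup>2 / 4)) *
      symmetric_form.\<Phi> W (two_row_form W g D) (\<lambda>k. hafnian (W - {k}) D) (g u) (g v)"
  have F: "complex_of_real (cmod (?F g D)) = ?F ?g D" for D
  proof -
    interpret symmetric_form W "two_row_form W g D" "\<lambda>k. hafnian (W - {k}) D"
      using W by (rule symmetric_two_row_form)
    have g: "?g j = g j" if "j \<in> W" for j
      using that uv by auto
    have g_uv: "?g u = 0" "?g v = merge_coeff (g u) (g v)"
      using uv by auto
    have two_row: "two_row_form W ?g D = two_row_form W g D"
      unfolding two_row_form_def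
      by (intro ext if_cong[OF refl refl] sum.cong refl arg_cong2[where f="(*)"] g) auto
    have sum: "(\<Sum>j\<in>W. ?g j * hafnian (W - {j}) D) = (\<Sum>j\<in>W. g j * hafnian (W - {j}) D)"
      by (intro sum.cong refl arg_cong2[where f="(*)"] g)
    show ?thesis
      unfolding two_row sum g_uv \<Phi>_merge_coeff[symmetric] by (simp add: norm_mult)
  qed
  have "cofactor_char ?V ?g = (\<integral>D. complex_of_real (cmod (?F g D)) \<partial>cgauss_vec (edges W))"
    unfolding F by (rule cofactor_char_two_rows[OF W uv])
  then have "cmod (cofactor_char ?V ?g) = \<bar>\<integral>D. cmod (?F g D) \<partial>cgauss_vec (edges W)\<bar>"
    by (simp only: integral_complex_of_real norm_of_real)
  moreover have "cmod (cofactor_char ?V g) \<le> (\<integral>D. cmod (?F g D) \<partial>cgauss_vec (edges W))"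
    unfolding cofactor_char_two_rows[OF W uv] by (rule integral_norm_bound)
  ultimately show ?thesis
    by linarith
qed

lemma cofactor_char_merge_all:
  assumes "finite V" "v \<in> V" "U \<subseteq> V - {v}"
  shows "\<exists>c. (cmod c)\<^sup>2 = (cmod (g v))\<^sup>2 + (\<Sum>u\<in>U. (cmod (g u))\<^sup>2) \<and>
    cmod (cofactor_char V g) \<le> cmod (cofactor_char V (\<lambda>j. if j = v then c else if j \<in> U then 0 else g j))"
proof -
  have "finite U"
    using assms by (meson finite_Diff finite_subset)
  then show ?thesis
    using assms(3)
  proof (induction U rule: finite_induct)
    case empty
    have "(\<lambda>j. if j = v then g v else if j \<in> {} then 0 else g j) = g"
      by auto
    then show ?case
      by (intro exI[of _ "g v"]) simp
  next
    case (insert u U)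
    then obtain c where c: "(cmod c)\<^sup>2 = (cmod (g v))\<^sup>2 + (\<Sum>u\<in>U. (cmod (g u))\<^sup>2)"
      and le: "cmod (cofactor_char V g) \<le> cmod (cofactor_char V (\<lambda>j. if j = v then c else if j \<in> U then 0 else g j))"
        (is "_ \<le> cmod (cofactor_char V ?h)")
      by auto
    let ?c = "merge_coeff (g u) c"
    define W where "W = V - {u, v}"
    have W: "finite W" "u \<noteq> v" "u \<notin> W" "v \<notin> W" and V: "V = insert v (insert u W)"
      using assms insert.prems by (auto simp: W_def)
    have "?h(u := 0, v := merge_coeff (?h u) (?h v))
        = (\<lambda>j. if j = v then ?c else if j \<in> insert u U then 0 else g j)"
      using insert.hyps W by auto
    then have "cmod (cofactor_char V ?h)
        \<le> cmod (cofactor_char V (\<lambda>j. if j = v then ?c else if j \<in> insert u U then 0 else g j))"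
      using cofactor_char_merge[OF W, of ?h, folded V] by simp
    with le c insert.hyps show ?case
      by (intro exI[of _ ?c]) (auto simp: cmod_merge_coeff)
  qed
qed

lemma cofactor_char_single:
  assumes W: "finite W" and uv: "u \<noteq> v" "u \<notin> W" "v \<notin> W"
  shows "cofactor_char (insert v (insert u W)) (\<lambda>j. if j = v then c else 0)
    = of_real (\<integral>D. exp (- ((cmod c)\<^sup>2 * cofactor_norm2 W D) / 4) \<partial>cgauss_vec (edges W))"
  unfolding cofactor_char_two_rows[OF W uv] integral_complex_of_real[symmetric]
proof (rule Bochner_Integration.integral_cong[OF refl])
  fix D
  let ?g = "\<lambda>j. if j = v then c else 0"
  interpret symmetric_form W "two_row_form W ?g D" "\<lambda>k. hafnian (W - {k}) D"
    using W by (rule symmetric_two_row_form)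
  have g0: "?g j = 0" if "j \<in> W" for j
    using that uv by auto
  have "row x l = 0" for x l
    unfolding row_def two_row_form_def by (intro sum.neutral ballI) (auto simp: g0)
  then have "nrm2 0 x = 0" for x
    by (simp add: nrm2_def)
  then have "\<Phi> 0 c = (\<integral>x. cis (Re (\<Sum>k\<in>W. (c * hafnian (W - {k}) D) * x k)) \<partial>cgauss_vec W)"
    unfolding \<Phi>_eq lin_def by (simp add: sum_distrib_left mult.assoc del: times_complex.sel Re_sum)
  also have "\<dots> = of_real (exp (- (\<Sum>k\<in>W. (cmod (c * hafnian (W - {k}) D))\<^sup>2) / 4))"
    by (rule cgauss_vec_char[OF W])
  also have "(\<Sum>k\<in>W. (cmod (c * hafnian (W - {k}) D))\<^sup>2) = (cmod c)\<^sup>2 * cofactor_norm2 W D"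
    by (simp add: cofactor_norm2_def sum_distrib_left norm_mult power_mult_distrib)
  finally show "of_real (exp (- (cmod (\<Sum>j\<in>W. ?g j * hafnian (W - {j}) D))\<^sup>2 / 4)) * \<Phi> (?g u) (?g v)
      = complex_of_real (exp (- ((cmod c)\<^sup>2 * cofactor_norm2 W D) / 4))"
    using uv g0 by simp
qed

lemma cofactor_char_bound:
  assumes W: "finite W" and uv: "u \<noteq> v" "u \<notin> W" "v \<notin> W"
  shows "cmod (cofactor_char (insert v (insert u W)) g)
    \<le> (\<integral>D. exp (- ((\<Sum>j\<in>insert v (insert u W). (cmod (g j))\<^sup>2) * cofactor_norm2 W D) / 4)
        \<partial>cgauss_vec (edges W))"
proof -
  let ?V = "insert v (insert u W)"
  obtain c where c: "(cmod c)\<^sup>2 = (cmod (g v))\<^sup>2 + (\<Sum>j\<in>insert u W. (cmod (g j))\<^sup>2)"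
    and le: "cmod (cofactor_char ?V g)
      \<le> cmod (cofactor_char ?V (\<lambda>j. if j = v then c else if j \<in> insert u W then 0 else g j))"
    using cofactor_char_merge_all[of ?V v "insert u W" g] W uv by auto
  have "cofactor_form ?V (\<lambda>j. if j = v then c else if j \<in> insert u W then 0 else g j)
      = cofactor_form ?V (\<lambda>j. if j = v then c else 0)"
    by (auto simp: cofactor_form_def fun_eq_iff intro!: sum.cong)
  then have "cofactor_char ?V (\<lambda>j. if j = v then c else if j \<in> insert u W then 0 else g j)
      = of_real (\<integral>D. exp (- ((cmod c)\<^sup>2 * cofactor_norm2 W D) / 4) \<partial>cgauss_vec (edges W))"
    unfolding cofactor_char_def[of ?V] by (simp only: cofactor_char_def[symmetric] cofactor_char_single[OF W uv])
  moreover have "(\<integral>D. exp (- ((cmod c)\<^sup>2 * cofactor_norm2 W D) / 4) \<partial>cgauss_vec (edges W)) \<ge> 0"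
    by (rule Bochner_Integration.integral_nonneg) simp
  moreover have "(cmod c)\<^sup>2 = (\<Sum>j\<in>?V. (cmod (g j))\<^sup>2)"
    using c W uv by simp
  ultimately show ?thesis
    using le by simp
qed

section \<open>Laplace transforms and negative moments\<close>

definition gamma_weight :: "real \<Rightarrow> real \<Rightarrow> real \<Rightarrow> ennreal" where
  "gamma_weight a x t = ennreal (indicator {0..} t * t powr (a - 1) * exp (- (x * t)))"

lemma measurable_gamma_weight [measurable]:
  assumes "f \<in> borel_measurable M" "g \<in> borel_measurable M"
  shows "(\<lambda>w. gamma_weight a (f w) (g w)) \<in> borel_measurable M"
proof -
  have [measurable]: "(\<lambda>p. gamma_weight a (fst p) (snd p)) \<in> borel_measurable (borel \<Otimes>\<^sub>M borel)"
    unfolding gamma_weight_def by measurable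
  note [measurable] = assms
  have "(\<lambda>w. (\<lambda>p. gamma_weight a (fst p) (snd p)) (f w, g w)) \<in> borel_measurable M"
    by measurable
  then show ?thesis
    by simp
qed

lemma gamma_weight_add:
  "gamma_weight a (x + y) t = gamma_weight a x t * ennreal (exp (- (t * y)))"
  by (simp add: gamma_weight_def ennreal_mult'[symmetric] exp_diff exp_minus algebra_simps
      divide_inverse)

lemma Gamma_real_neq_0: "a > 0 \<Longrightarrow> Gamma a \<noteq> (0 :: real)"
  using Gamma_real_pos[of a] by force

lemma nn_integral_gamma_weight_pos:
  assumes "a > 0" "x > 0"
  shows "(\<integral>\<^sup>+t. gamma_weight a x t \<partial>lborel) = ennreal (Gamma a / x powr a)"
proof -
  have "ennreal (Gamma a) = (\<integral>\<^sup>+t. ennreal (indicator {0..} t * t powr (a - 1) / exp t) \<partial>lborel)"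
    using assms(1) by (rule Gamma_conv_nn_integral_real)
  also have "\<dots> = ennreal \<bar>x\<bar> * (\<integral>\<^sup>+t. ennreal (indicator {0..} (0 + x * t) * (0 + x * t) powr (a - 1)
      / exp (0 + x * t)) \<partial>lborel)"
    using assms by (intro nn_integral_real_affine) simp_all
  also have "\<dots> = (\<integral>\<^sup>+t. ennreal (x powr a) * gamma_weight a x t \<partial>lborel)"
  proof (subst nn_integral_cmult[symmetric], simp, rule nn_integral_cong)
    fix t :: real
    have xa: "x * x powr (a - 1) = x powr a"
      using assms by (simp add: powr_mult_base)
    have "indicator {0..} (0 + x * t) = (indicator {0..} t :: real)"
      using assms by (simp add: indicator_def zero_le_mult_iff)
    then have "x * (indicator {0..} (0 + x * t) * (0 + x * t) powr (a - 1) / exp (0 + x * t))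
        = x powr a * (indicator {0..} t * t powr (a - 1) * exp (- (x * t)))"
      using assms by (cases "t \<ge> 0") (simp_all add: powr_mult exp_minus divide_inverse xa[symmetric])
    then show "ennreal \<bar>x\<bar> * ennreal (indicator {0..} (0 + x * t) * (0 + x * t) powr (a - 1) / exp (0 + x * t))
        = ennreal (x powr a) * gamma_weight a x t"
      using assms by (simp add: gamma_weight_def ennreal_mult'[symmetric])
  qed
  also have "\<dots> = ennreal (x powr a) * (\<integral>\<^sup>+t. gamma_weight a x t \<partial>lborel)"
    by (rule nn_integral_cmult) simp
  finally have "inverse (ennreal (x powr a)) * ennreal (Gamma a)
      = (inverse (ennreal (x powr a)) * ennreal (x powr a)) * (\<integral>\<^sup>+t. gamma_weight a x t \<partial>lborel)"
    by (simp add: mult.assoc)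
  then show ?thesis
    using assms by (simp add: inverse_ennreal ennreal_mult'[symmetric] divide_inverse mult.commute)
qed

lemma nn_integral_gamma_weight:
  assumes a: "a > 0" and "x \<ge> 0"
  shows "(\<integral>\<^sup>+t. gamma_weight a x t \<partial>lborel) = ennreal (Gamma a) * inverse (ennreal (x powr a))"
proof (cases "x = 0")
  case False
  then show ?thesis
    using assms by (simp add: nn_integral_gamma_weight_pos inverse_ennreal ennreal_mult'[symmetric]
        divide_inverse Gamma_real_nonneg)
next
  case True
  have ge: "(\<integral>\<^sup>+t. gamma_weight a 0 t \<partial>lborel) \<ge> ennreal K" if "K > 0" for K
  proof -
    define y where "y = (Gamma a / K) powr (1 / a)"
    have y: "y > 0" "y powr a = Gamma a / K"
      using that a by (auto simp: y_def powr_powr Gamma_real_neq_0)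
    have "ennreal K = (\<integral>\<^sup>+t. gamma_weight a y t \<partial>lborel)"
      using y a that Gamma_real_neq_0[OF a] by (simp add: nn_integral_gamma_weight_pos)
    also have "\<dots> \<le> (\<integral>\<^sup>+t. gamma_weight a 0 t \<partial>lborel)"
    proof (rule nn_integral_mono)
      fix t :: real
      show "gamma_weight a y t \<le> gamma_weight a 0 t"
        using y(1) by (cases "t \<ge> 0")
          (auto simp: gamma_weight_def intro!: ennreal_leI mult_left_le mult_nonneg_nonneg)
    qed
    finally show ?thesis .
  qed
  have "(\<integral>\<^sup>+t. gamma_weight a 0 t \<partial>lborel) = top"
  proof (cases "\<integral>\<^sup>+t. gamma_weight a 0 t \<partial>lborel" rule: ennreal_cases)
    case (real r)
    then show ?thesis
      using ge[of "r + 1"] by simp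
  qed
  then show ?thesis
    using True a by (simp add: Gamma_real_neq_0 ennreal_mult_top)
qed

lemma inverse_powr_le_of_laplace_le:
  assumes "sigma_finite_measure P" "sigma_finite_measure Q"
    and [measurable]: "X \<in> borel_measurable P" "Y \<in> borel_measurable Q"
    and X: "\<And>w. X w \<ge> 0" and Y: "\<And>w. Y w \<ge> 0" and q: "q > 0"
    and le: "\<And>s. s \<ge> 0 \<Longrightarrow> (\<integral>\<^sup>+w. ennreal (exp (- (s * X w))) \<partial>P) \<le> (\<integral>\<^sup>+w. ennreal (exp (- (s * Y w))) \<partial>Q)"
  shows "(\<integral>\<^sup>+w. inverse (ennreal (X w powr q)) \<partial>P) \<le> (\<integral>\<^sup>+w. inverse (ennreal (Y w powr q)) \<partial>Q)"
proof -
  have conv: "ennreal (Gamma q) * (\<integral>\<^sup>+w. inverse (ennreal (X w powr q)) \<partial>P)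
      = (\<integral>\<^sup>+s. gamma_weight q 0 s * (\<integral>\<^sup>+w. ennreal (exp (- (s * X w))) \<partial>P) \<partial>lborel)"
    if "sigma_finite_measure P" and [measurable]: "X \<in> borel_measurable P" and X: "\<And>w. X w \<ge> 0"
    for P :: "'c measure" and X
  proof -
    interpret pair_sigma_finite P lborel
      using that(1) by (simp add: pair_sigma_finite_def sigma_finite_lborel)
    have "ennreal (Gamma q) * (\<integral>\<^sup>+w. inverse (ennreal (X w powr q)) \<partial>P)
        = (\<integral>\<^sup>+w. \<integral>\<^sup>+s. gamma_weight q (X w) s \<partial>lborel \<partial>P)"
      by (simp add: nn_integral_gamma_weight q X nn_integral_cmult)
    also have "\<dots> = (\<integral>\<^sup>+s. \<integral>\<^sup>+w. gamma_weight q (X w) s \<partial>P \<partial>lborel)"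
      by (rule Fubini'[symmetric]) simp
    also have "\<dots> = (\<integral>\<^sup>+s. gamma_weight q 0 s * (\<integral>\<^sup>+w. ennreal (exp (- (s * X w))) \<partial>P) \<partial>lborel)"
    proof (rule nn_integral_cong)
      fix s
      have "gamma_weight q (X w) s = gamma_weight q 0 s * ennreal (exp (- (s * X w)))" for w
        using gamma_weight_add[of q 0 "X w" s] by simp
      then show "(\<integral>\<^sup>+w. gamma_weight q (X w) s \<partial>P)
          = gamma_weight q 0 s * (\<integral>\<^sup>+w. ennreal (exp (- (s * X w))) \<partial>P)"
        by (simp only:) (rule nn_integral_cmult, simp)
    qed
    finally show ?thesis .
  qed
  have "ennreal (Gamma q) * (\<integral>\<^sup>+w. inverse (ennreal (X w powr q)) \<partial>P)
      \<le> ennreal (Gamma q) * (\<integral>\<^sup>+w. inverse (ennreal (Y w powr q)) \<partial>Q)"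
    unfolding conv[OF assms(1,3) X] conv[OF assms(2,4) Y]
  proof (rule nn_integral_mono)
    fix s :: real
    show "gamma_weight q 0 s * (\<integral>\<^sup>+w. ennreal (exp (- (s * X w))) \<partial>P)
        \<le> gamma_weight q 0 s * (\<integral>\<^sup>+w. ennreal (exp (- (s * Y w))) \<partial>Q)"
    proof (cases "s \<ge> 0")
      case True
      then show ?thesis
        by (intro mult_left_mono le) simp_all
    next
      case False
      then show ?thesis
        by (simp add: gamma_weight_def)
    qed
  qed
  then show ?thesis
    using Gamma_real_pos[OF q] by (subst (asm) ennreal_mult_le_mult_iff) (auto simp del: Gamma_real_pos)
qed

lemma inverse_powr_gamma_bound:
  assumes "sigma_finite_measure P" and [measurable]: "R \<in> borel_measurable P"
    and R: "\<And>w. R w \<ge> 0" and q: "0 < q" "q < real d"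
    and le: "\<And>s. s \<ge> 0 \<Longrightarrow> (\<integral>\<^sup>+w. ennreal (exp (- (s * R w))) \<partial>P) \<le> ennreal (1 / (1 + s) ^ d)"
  shows "(\<integral>\<^sup>+w. inverse (ennreal (R w powr q)) \<partial>P) \<le> ennreal (Gamma (real d - q) / Gamma (real d))"
proof -
  have d: "real d > 0"
    using q by simp
  define Q where "Q = density lborel (\<lambda>t. gamma_weight d 1 t * ennreal (1 / Gamma (real d)))"
  have [measurable_cong]: "sets Q = sets borel"
    by (simp add: Q_def)
  have int_Q: "(\<integral>\<^sup>+t. f t \<partial>Q) = (\<integral>\<^sup>+t. gamma_weight d 1 t * f t \<partial>lborel) * ennreal (1 / Gamma (real d))"
    if [measurable]: "f \<in> borel_measurable borel" for f
    unfolding Q_def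
    by (subst nn_integral_density, simp, simp, subst nn_integral_multc[symmetric], simp)
      (simp add: mult_ac)
  have lap: "(\<integral>\<^sup>+t. ennreal (exp (- (s * \<bar>t\<bar>))) \<partial>Q) = ennreal (1 / (1 + s) ^ d)" if "s \<ge> 0" for s
  proof -
    have "gamma_weight d 1 t * ennreal (exp (- (s * \<bar>t\<bar>))) = gamma_weight d (1 + s) t" for t
    proof (cases "t \<ge> 0")
      case True
      then show ?thesis
        unfolding gamma_weight_add by (simp add: mult.commute[of s])
    qed (simp add: gamma_weight_def)
    then have "(\<integral>\<^sup>+t. ennreal (exp (- (s * \<bar>t\<bar>))) \<partial>Q)
        = ennreal (Gamma (real d) / (1 + s) powr d) * ennreal (1 / Gamma (real d))"
      using that d by (subst int_Q) (simp_all add: nn_integral_gamma_weight_pos)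
    also have "\<dots> = ennreal (1 / (1 + s) ^ d)"
      using that d Gamma_real_neq_0[OF d] by (simp add: ennreal_mult'[symmetric] powr_realpow)
    finally show ?thesis .
  qed
  have "emeasure Q (space Q) = 1"
    using lap[of 0] by simp
  then have "prob_space Q"
    by (rule prob_spaceI)
  then have "(\<integral>\<^sup>+w. inverse (ennreal (R w powr q)) \<partial>P) \<le> (\<integral>\<^sup>+t. inverse (ennreal (\<bar>t\<bar> powr q)) \<partial>Q)"
    using le lap q R by (intro inverse_powr_le_of_laplace_le assms(1) prob_space_imp_sigma_finite) auto
  also have "\<dots> = (\<integral>\<^sup>+t. gamma_weight (real d - q) 1 t \<partial>lborel) * ennreal (1 / Gamma (real d))"
  proof -
    have *: "gamma_weight d 1 t * inverse (ennreal (\<bar>t\<bar> powr q)) = gamma_weight (real d - q) 1 t"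
      if "t \<noteq> 0" for t
    proof (cases "t \<ge> 0")
      case True
      have "t powr (real d - 1) * inverse (t powr q) = t powr (real d - q - 1)"
        unfolding powr_minus[symmetric] powr_add[symmetric] by (simp add: algebra_simps)
      then show ?thesis
        using True that by (simp add: gamma_weight_def inverse_ennreal ennreal_mult'[symmetric] mult_ac)
    qed (simp add: gamma_weight_def)
    have "AE t in lborel. gamma_weight d 1 t * inverse (ennreal (\<bar>t\<bar> powr q))
        = gamma_weight (real d - q) 1 t"
      by (rule AE_mp[OF AE_lborel_singleton[of 0] AE_I2]) (simp add: *)
    then show ?thesis
      by (subst int_Q) (simp_all cong: nn_integral_cong_AE)
  qed
  also have "\<dots> = ennreal (Gamma (real d - q) / Gamma (real d))"
    using q d by (simp add: nn_integral_gamma_weight_pos ennreal_mult'[symmetric] Gamma_real_pos less_imp_le)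
  finally show ?thesis .
qed

section \<open>Negative moments of hafnians and cofactor vectors\<close>

lemma laplace_cofactor_norm2:
  assumes W: "finite W" and uv: "u \<noteq> v" "u \<notin> W" "v \<notin> W" and s: "s \<ge> 0"
  defines "V \<equiv> insert v (insert u W)"
  shows "(\<integral>\<^sup>+b. ennreal (exp (- (s * cofactor_norm2 V b))) \<partial>cgauss_vec (edges V))
    \<le> (\<integral>\<^sup>+g. \<integral>\<^sup>+D. ennreal (exp (- (s * ((\<Sum>j\<in>V. (cmod (g j))\<^sup>2) * cofactor_norm2 W D))))
        \<partial>cgauss_vec (edges W) \<partial>cgauss_vec V)"
proof -
  let ?E = "cgauss_vec (edges V)" and ?G = "cgauss_vec V"
  have fin: "finite V"
    using W by (simp add: V_def)
  interpret E: prob_space ?E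
    by (rule prob_space_cgauss_vec)
  interpret EW: prob_space "cgauss_vec (edges W)"
    by (rule prob_space_cgauss_vec)
  interpret P: pair_prob_space ?E ?G
    by (rule pair_prob_space_cgauss_vec)
  define r where "r = 2 * sqrt s"
  have r: "r\<^sup>2 = 4 * s"
    using s by (simp add: r_def power_mult_distrib)
  define h where "h b g = cis (Re (cofactor_form V (\<lambda>j. of_real r * g j) b))" for b g
  have h_alt: "h b g = cis (Re (\<Sum>j\<in>V. (of_real r * hafnian (V - {j}) b) * g j))" for b g
    by (simp only: h_def cofactor_form_def mult_ac)
  have char_g: "(\<integral>g. h b g \<partial>?G) = complex_of_real (exp (- (s * cofactor_norm2 V b)))" for b
    unfolding h_alt cgauss_vec_char[OF fin]
    by (simp add: norm_mult power_mult_distrib r cofactor_norm2_def sum_distrib_left[symmetric])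
  have char_b: "(\<integral>b. h b g \<partial>?E) = cofactor_char V (\<lambda>j. of_real r * g j)" for g
    by (simp add: h_def cofactor_char_def)
  have h_meas: "(\<lambda>p. h (fst p) (snd p)) \<in> borel_measurable (?E \<Otimes>\<^sub>M ?G)"
    unfolding h_alt by measurable
  have int: "integrable (?E \<Otimes>\<^sub>M ?G) (\<lambda>(b, g). h b g)"
    unfolding split_beta'
    by (rule P.integrable_const_bound[where B=1, OF _ h_meas]) (simp add: h_def)
  define L where "L = (\<integral>b. exp (- (s * cofactor_norm2 V b)) \<partial>?E)"
  have L_nonneg: "L \<ge> 0"
    unfolding L_def by (rule Bochner_Integration.integral_nonneg) simp
  have "complex_of_real L = (\<integral>b. (\<integral>g. h b g \<partial>?G) \<partial>?E)"
    unfolding char_g L_def by (rule integral_complex_of_real[symmetric])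
  also have "\<dots> = (\<integral>g. (\<integral>b. h b g \<partial>?E) \<partial>?G)"
    by (rule P.Fubini_integral[OF int, symmetric])
  finally have L: "complex_of_real L = (\<integral>g. cofactor_char V (\<lambda>j. of_real r * g j) \<partial>?G)"
    unfolding char_b .
  have int_g: "integrable ?G (\<lambda>g. cofactor_char V (\<lambda>j. of_real r * g j))"
    using P.integrable_snd[OF int] unfolding char_b .
  have "(\<integral>\<^sup>+b. ennreal (exp (- (s * cofactor_norm2 V b))) \<partial>?E) = ennreal L"
    unfolding L_def using s
    by (intro nn_integral_eq_integral E.integrable_const_bound[where B=1])
      (simp_all add: cofactor_norm2_nonneg)
  also have "\<dots> = ennreal (cmod (\<integral>g. cofactor_char V (\<lambda>j. of_real r * g j) \<partial>?G))"
    unfolding L[symmetric] using L_nonneg by simp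
  also have "\<dots> \<le> (\<integral>\<^sup>+g. ennreal (cmod (cofactor_char V (\<lambda>j. of_real r * g j))) \<partial>?G)"
    by (rule integral_norm_bound_ennreal[OF int_g])
  also have "\<dots> \<le> (\<integral>\<^sup>+g. \<integral>\<^sup>+D. ennreal (exp (- (s * ((\<Sum>j\<in>V. (cmod (g j))\<^sup>2) * cofactor_norm2 W D))))
        \<partial>cgauss_vec (edges W) \<partial>?G)"
  proof (rule nn_integral_mono)
    fix g
    have "(\<Sum>j\<in>V. (cmod (of_real r * g j))\<^sup>2) = 4 * s * (\<Sum>j\<in>V. (cmod (g j))\<^sup>2)"
      by (simp add: norm_mult power_mult_distrib r sum_distrib_left[symmetric])
    then have "cmod (cofactor_char V (\<lambda>j. of_real r * g j))
        \<le> (\<integral>D. exp (- (s * ((\<Sum>j\<in>V. (cmod (g j))\<^sup>2) * cofactor_norm2 W D))) \<partial>cgauss_vec (edges W))"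
      using cofactor_char_bound[OF W uv, of "\<lambda>j. of_real r * g j", folded V_def] by simp
    then have "ennreal (cmod (cofactor_char V (\<lambda>j. of_real r * g j)))
        \<le> ennreal (\<integral>D. exp (- (s * ((\<Sum>j\<in>V. (cmod (g j))\<^sup>2) * cofactor_norm2 W D))) \<partial>cgauss_vec (edges W))"
      by (rule ennreal_leI)
    also have "\<dots> = (\<integral>\<^sup>+D. ennreal (exp (- (s * ((\<Sum>j\<in>V. (cmod (g j))\<^sup>2) * cofactor_norm2 W D))))
        \<partial>cgauss_vec (edges W))"
      using s by (intro nn_integral_eq_integral[symmetric] EW.integrable_const_bound[where B=1])
        (simp_all add: cofactor_norm2_nonneg sum_nonneg)
    finally show "ennreal (cmod (cofactor_char V (\<lambda>j. of_real r * g j)))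
        \<le> (\<integral>\<^sup>+D. ennreal (exp (- (s * ((\<Sum>j\<in>V. (cmod (g j))\<^sup>2) * cofactor_norm2 W D))))
        \<partial>cgauss_vec (edges W))" .
  qed
  finally show ?thesis .
qed

lemma laplace_linear_form:
  assumes I: "finite I" and s: "s \<ge> 0"
  shows "(\<integral>\<^sup>+y. ennreal (exp (- (s * (cmod (\<Sum>i\<in>I. y i * c i))\<^sup>2))) \<partial>cgauss_vec I)
       = (\<integral>\<^sup>+z. ennreal (exp (- (s * ((cmod z)\<^sup>2 * (\<Sum>i\<in>I. (cmod (c i))\<^sup>2))))) \<partial>cgauss)"
proof -
  interpret I: prob_space "cgauss_vec I"
    by (rule prob_space_cgauss_vec)
  interpret P: pair_prob_space "cgauss_vec I" cgauss ..
  define r where "r = 2 * sqrt s"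
  have r: "r\<^sup>2 = 4 * s"
    using s by (simp add: r_def power_mult_distrib)
  define h where "h y z = cis (Re ((of_real r * (\<Sum>i\<in>I. y i * c i)) * z))" for y z
  have h_alt: "h y z = cis (Re (\<Sum>i\<in>I. (of_real r * z * c i) * y i))" for y z
    by (simp only: h_def sum_distrib_left sum_distrib_right mult_ac)
  have char_z: "(\<integral>z. h y z \<partial>cgauss) = complex_of_real (exp (- (s * (cmod (\<Sum>i\<in>I. y i * c i))\<^sup>2)))" for y
    unfolding h_def cgauss_char by (simp add: norm_mult power_mult_distrib r)
  have char_y: "(\<integral>y. h y z \<partial>cgauss_vec I)
      = complex_of_real (exp (- (s * ((cmod z)\<^sup>2 * (\<Sum>i\<in>I. (cmod (c i))\<^sup>2)))))" for z
    unfolding h_alt cgauss_vec_char[OF I]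
    by (simp add: norm_mult power_mult_distrib r sum_distrib_left[symmetric])
  have h_meas: "(\<lambda>p. h (fst p) (snd p)) \<in> borel_measurable (cgauss_vec I \<Otimes>\<^sub>M cgauss)"
    unfolding h_def by measurable
  have int: "integrable (cgauss_vec I \<Otimes>\<^sub>M cgauss) (\<lambda>(y, z). h y z)"
    unfolding split_beta'
    by (rule P.integrable_const_bound[where B=1, OF _ h_meas]) (simp add: h_def)
  have "complex_of_real (\<integral>y. exp (- (s * (cmod (\<Sum>i\<in>I. y i * c i))\<^sup>2)) \<partial>cgauss_vec I)
      = complex_of_real (\<integral>z. exp (- (s * ((cmod z)\<^sup>2 * (\<Sum>i\<in>I. (cmod (c i))\<^sup>2)))) \<partial>cgauss)"
    using P.Fubini_integral[OF int] unfolding char_y char_z integral_complex_of_real by (rule sym)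
  then have "(\<integral>y. exp (- (s * (cmod (\<Sum>i\<in>I. y i * c i))\<^sup>2)) \<partial>cgauss_vec I)
      = (\<integral>z. exp (- (s * ((cmod z)\<^sup>2 * (\<Sum>i\<in>I. (cmod (c i))\<^sup>2)))) \<partial>cgauss)"
    unfolding of_real_eq_iff .
  moreover have "(\<integral>\<^sup>+y. ennreal (exp (- (s * (cmod (\<Sum>i\<in>I. y i * c i))\<^sup>2))) \<partial>cgauss_vec I)
      = ennreal (\<integral>y. exp (- (s * (cmod (\<Sum>i\<in>I. y i * c i))\<^sup>2)) \<partial>cgauss_vec I)"
    using s by (intro nn_integral_eq_integral I.integrable_const_bound[where B=1]) simp_all
  moreover have "(\<integral>\<^sup>+z. ennreal (exp (- (s * ((cmod z)\<^sup>2 * (\<Sum>i\<in>I. (cmod (c i))\<^sup>2))))) \<partial>cgauss)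
      = ennreal (\<integral>z. exp (- (s * ((cmod z)\<^sup>2 * (\<Sum>i\<in>I. (cmod (c i))\<^sup>2)))) \<partial>cgauss)"
    using s by (intro nn_integral_eq_integral cgauss.integrable_const_bound[where B=1])
      (simp_all add: sum_nonneg)
  ultimately show ?thesis
    by simp
qed

lemma laplace_hafnian_insert:
  assumes V: "finite V" "v \<notin> V" and s: "s \<ge> 0"
  shows "(\<integral>\<^sup>+b. ennreal (exp (- (s * (cmod (hafnian (insert v V) b))\<^sup>2))) \<partial>cgauss_vec (edges (insert v V)))
    = (\<integral>\<^sup>+z. \<integral>\<^sup>+D. ennreal (exp (- (s * ((cmod z)\<^sup>2 * cofactor_norm2 V D)))) \<partial>cgauss_vec (edges V) \<partial>cgauss)"
proof -
  interpret E: prob_space "cgauss_vec (edges V)"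
    by (rule prob_space_cgauss_vec)
  interpret P: pair_prob_space cgauss "cgauss_vec (edges V)" ..
  have [measurable]: "hafnian (insert v V) \<in> borel_measurable (cgauss_vec (edges (insert v V)))"
    by (rule measurable_hafnian[OF order.refl measurable_ident_sets]) simp
  have "(\<integral>\<^sup>+b. ennreal (exp (- (s * (cmod (hafnian (insert v V) b))\<^sup>2))) \<partial>cgauss_vec (edges (insert v V)))
      = (\<integral>\<^sup>+D. \<integral>\<^sup>+y. ennreal (exp (- (s * (cmod (\<Sum>k\<in>V. y k * hafnian (V - {k}) D))\<^sup>2)))
          \<partial>cgauss_vec V \<partial>cgauss_vec (edges V))"
    by (subst nn_integral_add_vertex[OF V]) (simp_all add: hafnian_add_vertex_new[OF V])
  also have "\<dots> = (\<integral>\<^sup>+D. \<integral>\<^sup>+z. ennreal (exp (- (s * ((cmod z)\<^sup>2 * cofactor_norm2 V D)))) \<partial>cgauss \<partial>cgauss_vec (edges V))"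
    by (simp add: laplace_linear_form V s cofactor_norm2_def)
  also have "\<dots> = (\<integral>\<^sup>+z. \<integral>\<^sup>+D. ennreal (exp (- (s * ((cmod z)\<^sup>2 * cofactor_norm2 V D)))) \<partial>cgauss_vec (edges V) \<partial>cgauss)"
    by (rule P.Fubini') simp
  finally show ?thesis .
qed

lemma inverse_powr_product_bound:
  assumes "sigma_finite_measure P" and "prob_space Q" and "prob_space E"
    and [measurable]: "X \<in> borel_measurable P" "R \<in> borel_measurable Q" "N \<in> borel_measurable E"
    and X: "\<And>w. X w \<ge> 0" and R: "\<And>w. R w \<ge> 0" and N: "\<And>w. N w \<ge> 0"
    and q: "0 < q" "q < real d"
    and le: "\<And>s. s \<ge> 0 \<Longrightarrow> (\<integral>\<^sup>+w. ennreal (exp (- (s * X w))) \<partial>P)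
      \<le> (\<integral>\<^sup>+g. \<integral>\<^sup>+D. ennreal (exp (- (s * (R g * N D)))) \<partial>E \<partial>Q)"
    and lap: "\<And>s. s \<ge> 0 \<Longrightarrow> (\<integral>\<^sup>+w. ennreal (exp (- (s * R w))) \<partial>Q) \<le> ennreal (1 / (1 + s) ^ d)"
  shows "(\<integral>\<^sup>+w. inverse (ennreal (X w powr q)) \<partial>P)
    \<le> ennreal (Gamma (real d - q) / Gamma (real d)) * (\<integral>\<^sup>+D. inverse (ennreal (N D powr q)) \<partial>E)"
proof -
  interpret QE: pair_prob_space Q E
    using assms(2,3) by (simp add: pair_prob_space_def pair_sigma_finite_def prob_space_imp_sigma_finite)
  have "(\<integral>\<^sup>+w. inverse (ennreal (X w powr q)) \<partial>P)
      \<le> (\<integral>\<^sup>+p. inverse (ennreal ((R (fst p) * N (snd p)) powr q)) \<partial>(Q \<Otimes>\<^sub>M E))"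
  proof (rule inverse_powr_le_of_laplace_le[OF assms(1) QE.sigma_finite_measure_axioms])
    fix s :: real assume "s \<ge> 0"
    then show "(\<integral>\<^sup>+w. ennreal (exp (- (s * X w))) \<partial>P)
        \<le> (\<integral>\<^sup>+p. ennreal (exp (- (s * (R (fst p) * N (snd p))))) \<partial>(Q \<Otimes>\<^sub>M E))"
      using le by (simp add: QE.M2.nn_integral_fst[symmetric])
  qed (simp_all add: X R N q)
  also have "\<dots> = (\<integral>\<^sup>+g. \<integral>\<^sup>+D. inverse (ennreal (R g powr q)) * inverse (ennreal (N D powr q)) \<partial>E \<partial>Q)"
    by (simp add: QE.M2.nn_integral_fst[symmetric] powr_mult R N ennreal_mult' ennreal_inverse_mult)
  also have "\<dots> = (\<integral>\<^sup>+g. inverse (ennreal (R g powr q)) \<partial>Q) * (\<integral>\<^sup>+D. inverse (ennreal (N D powr q)) \<partial>E)"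
    by (simp add: nn_integral_cmult nn_integral_multc)
  also have "\<dots> \<le> ennreal (Gamma (real d - q) / Gamma (real d)) * (\<integral>\<^sup>+D. inverse (ennreal (N D powr q)) \<partial>E)"
    using inverse_powr_gamma_bound[OF prob_space_imp_sigma_finite[OF assms(2)] assms(5) R q lap]
    by (intro mult_right_mono) simp_all
  finally show ?thesis .
qed

definition cofactor_moment :: "nat set \<Rightarrow> real \<Rightarrow> ennreal" where
  "cofactor_moment V q = (\<integral>\<^sup>+b. inverse (ennreal (cofactor_norm2 V b powr q)) \<partial>cgauss_vec (edges V))"

lemma cofactor_moment_step:
  assumes W: "finite W" and uv: "u \<noteq> v" "u \<notin> W" "v \<notin> W"
    and q: "0 < q" "q < real (card W + 2)"
  shows "cofactor_moment (insert v (insert u W)) q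
    \<le> ennreal (Gamma (real (card W + 2) - q) / Gamma (real (card W + 2))) * cofactor_moment W q"
  unfolding cofactor_moment_def
proof (rule inverse_powr_product_bound[where R="\<lambda>g. \<Sum>j\<in>insert v (insert u W). (cmod (g j))\<^sup>2"
      and Q="cgauss_vec (insert v (insert u W))"])
  fix s :: real assume s: "s \<ge> 0"
  show "(\<integral>\<^sup>+w. ennreal (exp (- (s * cofactor_norm2 (insert v (insert u W)) w)))
        \<partial>cgauss_vec (edges (insert v (insert u W))))
      \<le> (\<integral>\<^sup>+g. \<integral>\<^sup>+D. ennreal (exp (- (s * ((\<Sum>j\<in>insert v (insert u W). (cmod (g j))\<^sup>2) * cofactor_norm2 W D))))
        \<partial>cgauss_vec (edges W) \<partial>cgauss_vec (insert v (insert u W)))"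
    by (rule laplace_cofactor_norm2[OF W uv s])
  have "card (insert v (insert u W)) = card W + 2"
    using W uv by simp
  then show "(\<integral>\<^sup>+w. ennreal (exp (- (s * (\<Sum>j\<in>insert v (insert u W). (cmod (w j))\<^sup>2))))
      \<partial>cgauss_vec (insert v (insert u W))) \<le> ennreal (1 / (1 + s) ^ (card W + 2))"
    using cgauss_vec_nn_integral_exp[of "insert v (insert u W)" s] W s by simp
qed (use q in \<open>auto intro!: prob_space_cgauss_vec prob_space_imp_sigma_finite sum_nonneg cofactor_norm2_nonneg
  simp del: sum.insert sum.insert_if\<close>)

lemma hafnian_moment_step:
  assumes V: "finite V" "v \<notin> V" and q: "0 < q" "q < 1"
  shows "(\<integral>\<^sup>+b. inverse (ennreal ((cmod (hafnian (insert v V) b))\<^sup>2 powr q)) \<partial>cgauss_vec (edges (insert v V)))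
    \<le> ennreal (Gamma (1 - q) / Gamma 1) * cofactor_moment V q"
proof -
  have [measurable]: "hafnian (insert v V) \<in> borel_measurable (cgauss_vec (edges (insert v V)))"
    by (rule measurable_hafnian[OF order.refl measurable_ident_sets]) simp
  have "(\<integral>\<^sup>+b. inverse (ennreal ((cmod (hafnian (insert v V) b))\<^sup>2 powr q)) \<partial>cgauss_vec (edges (insert v V)))
    \<le> ennreal (Gamma (real 1 - q) / Gamma (real 1)) * cofactor_moment V q"
    unfolding cofactor_moment_def
  proof (rule inverse_powr_product_bound[where R="\<lambda>z. (cmod z)\<^sup>2" and Q=cgauss])
    fix s :: real assume s: "s \<ge> 0"
    show "(\<integral>\<^sup>+b. ennreal (exp (- (s * (cmod (hafnian (insert v V) b))\<^sup>2))) \<partial>cgauss_vec (edges (insert v V)))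
      \<le> (\<integral>\<^sup>+z. \<integral>\<^sup>+D. ennreal (exp (- (s * ((cmod z)\<^sup>2 * cofactor_norm2 V D)))) \<partial>cgauss_vec (edges V) \<partial>cgauss)"
      using laplace_hafnian_insert[OF V s] by simp
    show "(\<integral>\<^sup>+z. ennreal (exp (- (s * (cmod z)\<^sup>2))) \<partial>cgauss) \<le> ennreal (1 / (1 + s) ^ 1)"
      using nn_integral_cgauss_exp[OF s] by simp
  qed (use q in \<open>auto intro!: prob_space_cgauss_vec prob_space_imp_sigma_finite cofactor_norm2_nonneg
      cgauss.prob_space_axioms\<close>)
  then show ?thesis
    by simp
qed

lemma cofactor_moment_bound:
  assumes q: "0 < q" "q < 3" and "n \<ge> 1"
  shows "cofactor_moment {1..2 * n - 1} q
    \<le> ennreal (\<Prod>j=2..n. Gamma (2 * real j - 1 - q) / Gamma (2 * real j - 1))"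
  using \<open>n \<ge> 1\<close>
proof (induction n rule: nat_induct_at_least)
  case base
  interpret E: prob_space "cgauss_vec (edges {Suc 0})"
    by (rule prob_space_cgauss_vec)
  have "hafnian {} b = 1" for b
    by (simp add: hafnian_def perfect_matchings_empty)
  then have "cofactor_norm2 {Suc 0} b = 1" for b
    by (simp add: cofactor_norm2_def)
  then show ?case
    by (simp add: cofactor_moment_def E.emeasure_space_1)
next
  case (Suc n)
  let ?f = "\<lambda>j. Gamma (2 * real j - 1 - q) / Gamma (2 * real j - 1)"
  have V: "{1..2 * Suc n - 1} = insert (2 * n + 1) (insert (2 * n) {1..2 * n - 1})"
    using Suc.hyps by auto
  have card: "real (card {1..2 * n - 1} + 2) = 2 * real (Suc n) - 1"
    using Suc.hyps by (simp add: of_nat_diff)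
  have f: "?f (Suc n) \<ge> 0"
    using q Suc.hyps by (intro divide_nonneg_nonneg Gamma_real_nonneg) auto
  have "cofactor_moment {1..2 * Suc n - 1} q \<le> ennreal (?f (Suc n)) * cofactor_moment {1..2 * n - 1} q"
    using cofactor_moment_step[of "{1..2 * n - 1}" "2 * n" "2 * n + 1" q] q Suc.hyps
    unfolding V card by auto
  also have "\<dots> \<le> ennreal (?f (Suc n)) * ennreal (\<Prod>j=2..n. ?f j)"
    by (intro mult_left_mono Suc.IH) simp
  also have "\<dots> = ennreal (\<Prod>j=2..Suc n. ?f j)"
    using f Suc.hyps by (simp add: ennreal_mult'[symmetric] prod.nat_ivl_Suc' mult.commute)
  finally show ?case .
qed

lemma gaussian_symmetric_matrix_distr:
  assumes A: "gaussian_symmetric_matrix P m A" and m: "m \<ge> 2"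
  defines "X \<equiv> \<lambda>w. \<lambda>e\<in>edges {1..m}. A w (Min e) (Max e)"
  shows "X \<in> P \<rightarrow>\<^sub>M cgauss_vec (edges {1..m})"
    and "distr P (cgauss_vec (edges {1..m})) X = cgauss_vec (edges {1..m})"
proof -
  let ?K = "{(i, j). 1 \<le> i \<and> i < j \<and> j \<le> m}"
  let ?Y = "\<lambda>w. \<lambda>p\<in>?K. (case p of (i, j) \<Rightarrow> A w i j)"
  let ?f = "\<lambda>e :: nat set. (Min e, Max e)"
  interpret prob_space P
    using A by (simp add: gaussian_symmetric_matrix_def)
  have meas: "(\<lambda>w. A w i j) \<in> borel_measurable P" if "(i, j) \<in> ?K" for i j
    using A that by (auto simp: gaussian_symmetric_matrix_def)
  have f: "?f e \<in> ?K \<and> e = {Min e, Max e}" if "e \<in> edges {1..m}" for e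
  proof -
    from that have "card e = 2" and sub: "e \<subseteq> {1..m}"
      by (simp_all add: edges_def)
    then obtain p q where "e = {p, q}" "p \<noteq> q"
      by (meson card_2_iff)
    with sub show ?thesis
      by (cases "p < q") (auto simp: min_def max_def)
  qed
  have meas_Y [measurable]: "?Y \<in> P \<rightarrow>\<^sub>M cgauss_vec ?K"
    by (intro measurable_restrict) (auto intro: meas simp: measurable_cong_sets[OF refl sets_cgauss])
  have meas_f [measurable]: "(\<lambda>\<omega>. \<lambda>e\<in>edges {1..m}. \<omega> (?f e)) \<in> cgauss_vec ?K \<rightarrow>\<^sub>M cgauss_vec (edges {1..m})"
    using f by (intro measurable_restrict measurable_component_singleton) auto
  have X: "X = (\<lambda>w. \<lambda>e\<in>edges {1..m}. ?Y w (?f e))"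
    unfolding X_def using f by (auto simp: fun_eq_iff restrict_def)
  show "X \<in> P \<rightarrow>\<^sub>M cgauss_vec (edges {1..m})"
    unfolding X by measurable
  have "(1, 2) \<in> ?K"
    using m by simp
  then have "?K \<noteq> {}"
    by blast
  then have "distr P (Pi\<^sub>M ?K (\<lambda>_. borel)) ?Y = Pi\<^sub>M ?K (\<lambda>p. distr P borel (\<lambda>w. case p of (i, j) \<Rightarrow> A w i j))"
    using A meas
    by (subst indep_vars_iff_distr_eq_PiM'[symmetric])
      (auto simp: gaussian_symmetric_matrix_def split_beta')
  also have "\<dots> = cgauss_vec ?K"
    using A by (intro PiM_cong refl)
      (auto simp: gaussian_symmetric_matrix_def intro!: std_complex_gaussian_distr)
  also have "distr P (Pi\<^sub>M ?K (\<lambda>_. borel)) ?Y = distr P (cgauss_vec ?K) ?Y"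
    by (intro distr_cong refl sets_PiM_cong) simp_all
  finally have Y: "distr P (cgauss_vec ?K) ?Y = cgauss_vec ?K" .
  have "distr P (cgauss_vec (edges {1..m})) X
      = distr (distr P (cgauss_vec ?K) ?Y) (cgauss_vec (edges {1..m})) (\<lambda>\<omega>. \<lambda>e\<in>edges {1..m}. \<omega> (?f e))"
    unfolding X distr_distr[OF meas_f meas_Y] comp_def ..
  also have "\<dots> = cgauss_vec (edges {1..m})"
    unfolding Y
  proof (intro distr_PiM_reindex cgauss.prob_space_axioms inj_onI)
    fix e e' assume e: "e \<in> edges {1..m}" "e' \<in> edges {1..m}" and "?f e = ?f e'"
    then have "{Min e, Max e} = {Min e', Max e'}"
      by simp
    then show "e = e'"
      using f[OF e(1)] f[OF e(2)] by simp
  qed (use f in auto)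
  finally show "distr P (cgauss_vec (edges {1..m})) X = cgauss_vec (edges {1..m})" .
qed

lemma haf_eq_hafnian:
  assumes "I \<subseteq> V"
  shows "haf I A = hafnian I (\<lambda>e\<in>edges V. A (Min e) (Max e))"
  unfolding hafnian_def haf_def
proof (intro sum.cong prod.cong refl)
  fix M e assume "M \<in> perfect_matchings I" "e \<in> M"
  then have "e \<in> edges V"
    using perfect_matchings_edges edges_mono[OF assms] by (meson subsetD)
  then show "A (Min e) (Max e) = (\<lambda>e\<in>edges V. A (Min e) (Max e)) e"
    by simp
qed

lemma inverse_moment_cofactor_norm:
  assumes A: "gaussian_symmetric_matrix P m A" and m: "m \<ge> 2"
  shows "inverse_moment P (2 * q)
      (\<lambda>w. L2_set (\<lambda>j. cmod (haf_cofactor {1..m} (A w) j)) {1..m})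
    = cofactor_moment {1..m} q"
proof -
  define X where "X = (\<lambda>w. \<lambda>e\<in>edges {1..m}. A w (Min e) (Max e))"
  note X = gaussian_symmetric_matrix_distr[OF A m, folded X_def]
  have "L2_set (\<lambda>j. cmod (haf_cofactor {1..m} (A w) j)) {1..m} powr (2 * q)
      = cofactor_norm2 {1..m} (X w) powr q" for w
  proof -
    have "haf_cofactor {1..m} (A w) j = hafnian ({1..m} - {j}) (X w)" for j
      unfolding haf_cofactor_def X_def by (rule haf_eq_hafnian) auto
    then have "L2_set (\<lambda>j. cmod (haf_cofactor {1..m} (A w) j)) {1..m}
        = cofactor_norm2 {1..m} (X w) powr (1/2)"
      by (simp add: L2_set_def cofactor_norm2_def powr_half_sqrt sum_nonneg)
    then show ?thesis
      by (simp add: powr_powr)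
  qed
  then have "inverse_moment P (2 * q)
      (\<lambda>w. L2_set (\<lambda>j. cmod (haf_cofactor {1..m} (A w) j)) {1..m})
      = (\<integral>\<^sup>+w. inverse (ennreal (cofactor_norm2 {1..m} (X w) powr q)) \<partial>P)"
    by (simp add: inverse_moment_def)
  also have "\<dots> = (\<integral>\<^sup>+b. inverse (ennreal (cofactor_norm2 {1..m} b powr q))
      \<partial>distr P (cgauss_vec (edges {1..m})) X)"
    by (rule nn_integral_distr[symmetric, OF X(1)]) simp
  finally show ?thesis
    unfolding X(2) cofactor_moment_def .
qed

lemma inverse_moment_hafnian:
  assumes A: "gaussian_symmetric_matrix P m A" and m: "m \<ge> 2"
  shows "inverse_moment P (2 * q) (\<lambda>w. cmod (haf {1..m} (A w)))
    = (\<integral>\<^sup>+b. inverse (ennreal ((cmod (hafnian {1..m} b))\<^sup>2 powr q)) \<partial>cgauss_vec (edges {1..m}))"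
proof -
  define X where "X = (\<lambda>w. \<lambda>e\<in>edges {1..m}. A w (Min e) (Max e))"
  note X = gaussian_symmetric_matrix_distr[OF A m, folded X_def]
  have [measurable]: "hafnian {1..m} \<in> borel_measurable (cgauss_vec (edges {1..m}))"
    by (rule measurable_hafnian[OF order.refl measurable_ident_sets]) simp
  have "cmod (haf {1..m} (A w)) powr (2 * q) = (cmod (hafnian {1..m} (X w)))\<^sup>2 powr q" for w
  proof -
    have "haf {1..m} (A w) = hafnian {1..m} (X w)"
      unfolding X_def by (rule haf_eq_hafnian) simp
    moreover have "x powr (2 * q) = x\<^sup>2 powr q" if "x \<ge> 0" for x :: real
      using that by (cases "x = 0") (simp_all add: powr_powr flip: powr_numeral)
    ultimately show ?thesis
      by simp
  qed
  then have "inverse_moment P (2 * q) (\<lambda>w. cmod (haf {1..m} (A w)))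
      = (\<integral>\<^sup>+w. inverse (ennreal ((cmod (hafnian {1..m} (X w)))\<^sup>2 powr q)) \<partial>P)"
    by (simp add: inverse_moment_def)
  also have "\<dots> = (\<integral>\<^sup>+b. inverse (ennreal ((cmod (hafnian {1..m} b))\<^sup>2 powr q))
      \<partial>distr P (cgauss_vec (edges {1..m})) X)"
    by (rule nn_integral_distr[symmetric, OF X(1)]) measurable
  finally show ?thesis
    unfolding X(2) .
qed

theorem corollary5p3:
  shows "(\<forall>(n::nat) (q::real) (P :: 'v measure) B.
            2 \<le> n \<longrightarrow> 0 < q \<longrightarrow> q < 3 \<longrightarrow> gaussian_symmetric_matrix P (2 * n - 1) B \<longrightarrow>
            inverse_moment P (2 * q)
              (\<lambda>w. L2_set (\<lambda>j. cmod (haf_cofactor {1..2 * n - 1} (B w) j)) {1..2 * n - 1})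
            \<le> ennreal (\<Prod>j=2..n. Gamma (2 * real j - 1 - q) / Gamma (2 * real j - 1)))
       \<and> (\<forall>(n::nat) (q::real) (P :: 'w measure) G.
            1 \<le> n \<longrightarrow> 0 < q \<longrightarrow> q < 1 \<longrightarrow> gaussian_symmetric_matrix P (2 * n) G \<longrightarrow>
            inverse_moment P (2 * q) (\<lambda>w. cmod (haf {1..2 * n} (G w)))
            \<le> ennreal (\<Prod>j=1..n. Gamma (2 * real j - 1 - q) / Gamma (2 * real j - 1)))"
proof (intro conjI allI impI)
  fix n :: nat and q :: real and P :: "'v measure" and B
  assume n: "2 \<le> n" and q: "0 < q" "q < 3" and B: "gaussian_symmetric_matrix P (2 * n - 1) B"
  have "2 * n - 1 \<ge> 2"
    using n by simp
  then show "inverse_moment P (2 * q)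
      (\<lambda>w. L2_set (\<lambda>j. cmod (haf_cofactor {1..2 * n - 1} (B w) j)) {1..2 * n - 1})
      \<le> ennreal (\<Prod>j=2..n. Gamma (2 * real j - 1 - q) / Gamma (2 * real j - 1))"
    using cofactor_moment_bound[OF q, of n] n by (simp only: inverse_moment_cofactor_norm[OF B])
next
  fix n :: nat and q :: real and P :: "'w measure" and G
  assume n: "1 \<le> n" and q: "0 < q" "q < 1" and G: "gaussian_symmetric_matrix P (2 * n) G"
  let ?f = "\<lambda>j. Gamma (2 * real j - 1 - q) / Gamma (2 * real j - 1)"
  have m: "2 * n \<ge> 2" and V: "{1..2 * n} = insert (2 * n) {1..2 * n - 1}"
    using n by auto
  have "inverse_moment P (2 * q) (\<lambda>w. cmod (haf {1..2 * n} (G w)))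
      \<le> ennreal (Gamma (1 - q) / Gamma 1) * cofactor_moment {1..2 * n - 1} q"
    unfolding inverse_moment_hafnian[OF G m] unfolding V by (rule hafnian_moment_step) (use n q in auto)
  also have "\<dots> \<le> ennreal (Gamma (1 - q) / Gamma 1) * ennreal (\<Prod>j=2..n. ?f j)"
    using q n by (intro mult_left_mono cofactor_moment_bound) auto
  also have "\<dots> = ennreal (\<Prod>j=1..n. ?f j)"
  proof -
    have "{1..n} = insert 1 {2..n}"
      using n by auto
    then show ?thesis
      using q by (simp add: ennreal_mult'[symmetric] Gamma_real_nonneg)
  qed
  finally show "inverse_moment P (2 * q) (\<lambda>w. cmod (haf {1..2 * n} (G w))) \<le> ennreal (\<Prod>j=1..n. ?f j)" .
qed

end
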